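(* Fix a hyperplane $\mathbb{P}^n$ inside $\mathbb{P}^{n+1}$ (over $\mathbb{C}$) and an integer $d\geq 1$. Let $Z$ be a general set of $\binom{d+n}{n}$ points in $\mathbb{P}^{n+1}$. For a point $P\in\mathbb{P}^{n+1}$ let $\pi_P$ be the projection from $P$ to $\mathbb{P}^n$. Let $\Sigma$ be the $d$-Weddle scheme of $Z$, i.e. the $d$-Weddle scheme of points $P\in\mathbb{P}^{n+1}$ for which $\pi_P(Z)$ lies on a hypersurface of degree $d$ in $\mathbb{P}^n$. Then $\Sigma$ is defined by a form of degree $\binom{d+n}{n+1}$.
   Context: "General" means: for all sets of points corresponding to a nonempty Zariski open subset of the parameter space. Definition of the $d$-Weddle scheme. Let $Z=\{P_1,\dots,P_r\}\subset\mathbb{P}^{m}$ be a finite set of distinct points and $R=\mathbb{C}[x_0,\dots,x_m]$. Let $M_1,\dots,M_{\binom{m+d}{m}}$ be the monomials of degree $d$ and $m_1,\dots,m_{\binom{m+d-1}{m}}$ those of degree $d-1$. The interpolation matrix $\Lambda(Z+dQ,d)$, with $Q=[x_0:\dots:x_m]$, has columns indexed by the $M_j$; its first $r$ rows have entries $M_j(P_i)$ (for fixed coordinate representatives of the $P_i$), and its remaining rows, indexed by the $m_i$, have entries $\partial_{m_i}M_j$, where $\partial_{m}$ is the differential operator $\partial^{i_0+\cdots+i_m}/\partial x_0^{i_0}\cdots\partial x_m^{i_m}$ for $m=x_0^{i_0}\cdots x_m^{i_m}$. (For $P\in\mathbb{P}^m$, the kernel of the matrix specialized at $Q=P$ is $[I(Z)\cap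 I(P)^d]_d$, the space of degree $d$ cones with vertex $P$ containing $Z$.) Let $\rho$ be the rank of this matrix for general $Q$. The $d$-Weddle ideal of $Z$ is the ideal of $R$ generated by the $\rho\times\rho$ minors of $\Lambda(Z+dQ,d)$, and the $d$-Weddle scheme of $Z$ is the subscheme of $\mathbb{P}^m$ defined by the saturation of this ideal. *)

theory Defs
  imports
    Complex_Main
    "HOL-Library.Poly_Mapping"
    "HOL-Algebra.Ideal"
    "Jordan_Normal_Form.DL_Rank"
    "Jordan_Normal_Form.DL_Submatrix"
begin

section \<open>Polynomials\<close>

text \<open>Polynomials with variables indexed by \<open>'v\<close> are finitely supported families of
  coefficients, indexed by exponent vectors.\<close>

type_synonym 'v monomial = "'v \<Rightarrow>\<^sub>0 nat"
type_synonym 'v cpoly = "'v monomial \<Rightarrow>\<^sub>0 complex"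

definition mono_deg :: "'v monomial \<Rightarrow> nat" where
  "mono_deg t = (\<Sum>v\<in>Poly_Mapping.keys t. Poly_Mapping.lookup t v)"

definition mono_eval :: "('v \<Rightarrow> complex) \<Rightarrow> 'v monomial \<Rightarrow> complex" where
  "mono_eval a t = (\<Prod>v\<in>Poly_Mapping.keys t. a v ^ Poly_Mapping.lookup t v)"

definition poly_eval :: "('v \<Rightarrow> complex) \<Rightarrow> 'v cpoly \<Rightarrow> complex" where
  "poly_eval a f = (\<Sum>t\<in>Poly_Mapping.keys f. Poly_Mapping.lookup f t * mono_eval a t)"

text \<open>The ring \<open>\<complex>[x\<^sub>0, \<dots>, x\<^sub>m]\<close>, inside the polynomials in countably many variables.\<close>

definition poly_ring :: "nat \<Rightarrow> nat cpoly ring" where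
  "poly_ring m = \<lparr>carrier = {f. \<forall>t\<in>Poly_Mapping.keys f. Poly_Mapping.keys t \<subseteq> {..m}},
     monoid.mult = (*), one = 1, ring.zero = 0, ring.add = (+)\<rparr>"

definition monomials :: "nat \<Rightarrow> nat \<Rightarrow> nat monomial set" where
  "monomials m e = {t. Poly_Mapping.keys t \<subseteq> {..m} \<and> mono_deg t = e}"

definition is_form :: "nat \<Rightarrow> nat \<Rightarrow> nat cpoly \<Rightarrow> bool" where
  "is_form m e f \<longleftrightarrow> f \<noteq> 0 \<and> Poly_Mapping.keys f \<subseteq> monomials m e"

definition pderiv_var :: "nat \<Rightarrow> nat cpoly \<Rightarrow> nat cpoly" where
  "pderiv_var i f = (\<Sum>t\<in>Poly_Mapping.keys f.
     Poly_Mapping.single (t - Poly_Mapping.single i 1) (of_nat (Poly_Mapping.lookup t i) * Poly_Mapping.lookup f t))"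

definition diff_op :: "nat \<Rightarrow> nat monomial \<Rightarrow> nat cpoly \<Rightarrow> nat cpoly" where
  "diff_op m t f = fold (\<lambda>i. pderiv_var i ^^ Poly_Mapping.lookup t i) [0..<m + 1] f"

section \<open>Projective space\<close>

text \<open>A point of complex projective \<open>m\<close>-space is the set of all
  its homogeneous coordinate vectors.\<close>

definition proportional :: "nat \<Rightarrow> (complex vec \<times> complex vec) set" where
  "proportional m = {(v, w). v \<in> carrier_vec (m + 1) - {0\<^sub>v (m + 1)} \<and>
     (\<exists>c. c \<noteq> 0 \<and> w = c \<cdot>\<^sub>v v)}"

definition proj_space :: "nat \<Rightarrow> complex vec set set" where
  "proj_space m = (carrier_vec (m + 1) - {0\<^sub>v (m + 1)}) // proportional m"

definition vanishes_at :: "nat cpoly \<Rightarrow> complex vec set \<Rightarrow> bool" where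
  "vanishes_at f P \<longleftrightarrow> (\<forall>v\<in>P. poly_eval (\<lambda>j. v $ j) f = 0)"

definition is_hyperplane :: "nat \<Rightarrow> complex vec set set \<Rightarrow> bool" where
  "is_hyperplane m H \<longleftrightarrow> (\<exists>h \<in> carrier_vec (m + 1). h \<noteq> 0\<^sub>v (m + 1) \<and>
     H = {P \<in> proj_space m. \<forall>v\<in>P. scalar_prod h v = 0})"

definition proj_line :: "nat \<Rightarrow> complex vec set \<Rightarrow> complex vec set \<Rightarrow> complex vec set set" where
  "proj_line m P Q = {X \<in> proj_space m.
     \<exists>p\<in>P. \<exists>q\<in>Q. \<exists>x\<in>X. \<exists>a b. x = a \<cdot>\<^sub>v p + b \<cdot>\<^sub>v q}"

text \<open>The projection from \<open>P\<close> to the hyperplane \<open>H\<close>; meaningful at \<open>X\<close> only for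
  \<open>P \<notin> H\<close> and \<open>X \<noteq> P\<close>.\<close>

definition projection :: "nat \<Rightarrow> complex vec set set \<Rightarrow> complex vec set \<Rightarrow> complex vec set
    \<Rightarrow> complex vec set" where
  "projection m H P X = (THE Y. Y \<in> H \<and> Y \<in> proj_line m P X)"

text \<open>A hypersurface of degree \<open>d\<close> in \<open>H\<close> is cut out by a form of degree \<open>d\<close> on the ambient
  space that does not vanish identically on \<open>H\<close>.\<close>

definition on_hypersurface :: "nat \<Rightarrow> complex vec set set \<Rightarrow> nat \<Rightarrow> complex vec set set \<Rightarrow> bool"
  where
  "on_hypersurface m H d S \<longleftrightarrow> (\<exists>g. is_form m d g \<and> (\<exists>Y\<in>H. \<not> vanishes_at g Y) \<and>
     (\<forall>Y\<in>S. vanishes_at g Y))"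

section \<open>General position\<close>

text \<open>The parameter space of \<open>r\<close>-tuples of points is the \<open>r\<close>-fold product of projective
  \<open>m\<close>-space. Its Zariski closed sets are the zero loci of sets of multihomogeneous polynomials;
  the variable \<open>(i, j)\<close> is the \<open>j\<close>-th coordinate of the \<open>i\<close>-th point.\<close>

definition point_tuples :: "nat \<Rightarrow> nat \<Rightarrow> complex vec set list set" where
  "point_tuples m r = {ps. length ps = r \<and> set ps \<subseteq> proj_space m}"

definition multihomogeneous :: "nat \<Rightarrow> nat \<Rightarrow> (nat \<times> nat) cpoly \<Rightarrow> bool" where
  "multihomogeneous m r f \<longleftrightarrow> (\<exists>e. \<forall>t\<in>Poly_Mapping.keys f. Poly_Mapping.keys t \<subseteq> {..<r} \<times> {..m} \<and>
     (\<forall>i<r. (\<Sum>j\<le>m. Poly_Mapping.lookup t (i, j)) = e i))"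

definition zariski_open :: "nat \<Rightarrow> nat \<Rightarrow> complex vec set list set \<Rightarrow> bool" where
  "zariski_open m r U \<longleftrightarrow> (\<exists>S. (\<forall>f\<in>S. multihomogeneous m r f) \<and>
     U = {ps \<in> point_tuples m r. \<exists>f\<in>S. \<forall>vs. list_all2 (\<in>) vs ps \<longrightarrow>
            poly_eval (\<lambda>(i, j). (vs ! i) $ j) f \<noteq> 0})"

definition general_tuple :: "nat \<Rightarrow> nat \<Rightarrow> (complex vec set list \<Rightarrow> bool) \<Rightarrow> bool" where
  "general_tuple m r \<Phi> \<longleftrightarrow> (\<exists>U. zariski_open m r U \<and> U \<noteq> {} \<and> (\<forall>ps\<in>U. \<Phi> ps))"

definition general_point :: "nat \<Rightarrow> (complex vec set \<Rightarrow> bool) \<Rightarrow> bool" where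
  "general_point m \<Phi> \<longleftrightarrow> general_tuple m 1 (\<lambda>ps. \<Phi> (ps ! 0))"

definition general_set :: "nat \<Rightarrow> nat \<Rightarrow> (complex vec set set \<Rightarrow> bool) \<Rightarrow> bool" where
  "general_set m r \<Phi> \<longleftrightarrow> general_tuple m r (\<lambda>ps. distinct ps \<and> \<Phi> (set ps))"

section \<open>Weddle schemes\<close>

definition coordinate_reps :: "complex vec set set \<Rightarrow> complex vec list \<Rightarrow> bool" where
  "coordinate_reps Z vs \<longleftrightarrow> (\<exists>ps. distinct ps \<and> set ps = Z \<and> list_all2 (\<in>) vs ps)"

text \<open>The order of the monomials is immaterial; \<^const>\<open>sorted_list_of_set\<close> refers to the
  lexicographic order on exponent vectors.\<close>

definition monomial_list :: "nat \<Rightarrow> nat \<Rightarrow> nat monomial list" where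
  "monomial_list m e = sorted_list_of_set (monomials m e)"

definition interpolation_matrix :: "nat \<Rightarrow> nat \<Rightarrow> complex vec list \<Rightarrow> nat cpoly mat" where
  "interpolation_matrix m d vs =
    (let r = length vs; cs = monomial_list m d; ds = monomial_list m (d - 1) in
      mat (r + length ds) (length cs) (\<lambda>(i, j).
        if i < r then Poly_Mapping.single 0 (mono_eval (\<lambda>k. (vs ! i) $ k) (cs ! j))
        else diff_op m (ds ! (i - r)) (Poly_Mapping.single (cs ! j) 1)))"

definition matrix_at :: "nat cpoly mat \<Rightarrow> complex vec \<Rightarrow> complex mat" where
  "matrix_at A q = map_mat (poly_eval (\<lambda>j. q $ j)) A"

definition general_rank :: "nat \<Rightarrow> nat cpoly mat \<Rightarrow> nat" where
  "general_rank m A = (THE \<rho>.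
     general_point m (\<lambda>Q. \<forall>q\<in>Q. vec_space.rank (dim_row A) (matrix_at A q) = \<rho>))"

definition minors :: "nat \<Rightarrow> nat cpoly mat \<Rightarrow> nat cpoly set" where
  "minors k A = {det (submatrix A I J) | I J.
     I \<subseteq> {..<dim_row A} \<and> J \<subseteq> {..<dim_col A} \<and> card I = k \<and> card J = k}"

definition weddle_ideal :: "nat \<Rightarrow> nat \<Rightarrow> complex vec list \<Rightarrow> nat cpoly set" where
  "weddle_ideal m d vs = (let A = interpolation_matrix m d vs in
     genideal (poly_ring m) (minors (general_rank m A) A))"

text \<open>Saturation with respect to the irrelevant ideal, whose \<open>k\<close>-th power is generated by the
  monomials of degree \<open>k\<close>.\<close>

definition saturation :: "nat \<Rightarrow> nat cpoly set \<Rightarrow> nat cpoly set" where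
  "saturation m I = {f \<in> carrier (poly_ring m).
     \<exists>k. \<forall>t\<in>monomials m k. Poly_Mapping.single t 1 * f \<in> I}"

text \<open>A closed subscheme of projective space is represented by its saturated homogeneous ideal;
  this correspondence is one-to-one.\<close>

definition weddle_scheme :: "nat \<Rightarrow> nat \<Rightarrow> complex vec list \<Rightarrow> nat cpoly set" where
  "weddle_scheme m d vs = saturation m (weddle_ideal m d vs)"

definition scheme_points :: "nat \<Rightarrow> nat cpoly set \<Rightarrow> complex vec set set" where
  "scheme_points m I = {P \<in> proj_space m. \<forall>f\<in>I. vanishes_at f P}"

end

theory Submission
  imports Defs
begin

text \<open>
  Put \<open>m = n + 1\<close>. The interpolation matrix of \<open>(d + n) choose n\<close> points in projective \<open>m\<close>-space is
  square, because splitting the monomials of degree \<open>d\<close> in \<open>m + 1\<close> variables according to whether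
  \<open>x\<^sub>0\<close> occurs in them gives \<open>(d + n) choose n\<close> monomials without \<open>x\<^sub>0\<close> and \<open>(d + n) choose (n + 1)\<close>
  multiples of \<open>x\<^sub>0\<close>, as many as there are monomials of degree \<open>d - 1\<close>. Its rows for the points are
  constants, and each of the remaining \<open>(d + n) choose (n + 1)\<close> rows, being formed by derivatives of
  order \<open>d - 1\<close> of monomials of degree \<open>d\<close>, consists of linear forms in the vertex. The determinant
  \<open>F\<close> is therefore zero or a form of the desired degree. If it is not zero, then the generic rank is
  the full size (\<open>general_rank_square\<close>), the Weddle ideal is generated by \<open>F\<close>, and a principal ideal
  is saturated (\<open>saturation_principal\<close>); so \<open>F\<close> defines the Weddle scheme.

  The zeros of \<open>F\<close> are the vertices for which the matrix has a kernel. Up to nonzero factors, the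
  derivative rows compute the coefficients of the derivative of a form \<open>f\<close> in the direction of the
  vertex \<open>p\<close> (\<open>poly_eval_diff_op\<close>). A kernel vector is thus a form that vanishes at the points
  and is constant in direction \<open>p\<close>, that is, a cone with vertex \<open>p\<close>
  (\<open>det_interpolation_matrix_eq_0_iff\<close>). Restriction to the hyperplane and pullback along the
  projection exchange such cones with the hypersurfaces through the projected points
  (\<open>on_hypersurface_iff_has_cone\<close>).

  It remains to see that \<open>F\<close> is not zero for general points. It is enough that \<open>F\<close> does not vanish
  at the first coordinate point. This value of \<open>F\<close> is a multihomogeneous polynomial in the points,
  so it suffices to find one tuple of points where it is nonzero. Cones with this vertex are the forms
  in \<open>x\<^sub>1, \<dots>, x\<^sub>m\<close>. Take as points the vectors of \<open>i\<close>-th powers of distinct primes: a monomial takes at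
  them the \<open>i\<close>-th powers of its value at the primes, and by unique factorization different monomials
  have different values there, so a Vandermonde matrix shows that only the zero form vanishes
  at all of them (\<open>poly_zero_if_prime_powers\<close>, \<open>no_cone_prime_points\<close>).
\<close>

abbreviation keys :: "('a \<Rightarrow>\<^sub>0 'b::zero) \<Rightarrow> 'a set" where "keys \<equiv> Poly_Mapping.keys"
abbreviation lookup :: "('a \<Rightarrow>\<^sub>0 'b::zero) \<Rightarrow> 'a \<Rightarrow> 'b" where "lookup \<equiv> Poly_Mapping.lookup"
abbreviation single :: "'a \<Rightarrow> 'b \<Rightarrow> ('a \<Rightarrow>\<^sub>0 'b::zero)" where "single \<equiv> Poly_Mapping.single"

section \<open>Evaluation of polynomials\<close>

lemma sum_single_keys: "(\<Sum>t\<in>keys f. single t (lookup f t)) = f"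
  by (rule poly_mapping_eqI)
    (auto simp: lookup_sum lookup_single when_def sum.delta not_in_keys_iff_lookup_eq_zero)

lemma mono_eval_superset:
  assumes "finite V" "keys t \<subseteq> V"
  shows "mono_eval a t = (\<Prod>v\<in>V. a v ^ lookup t v)"
  unfolding mono_eval_def using assms
  by (intro prod.mono_neutral_left) (auto simp: in_keys_iff)

lemma mono_eval_0 [simp]: "mono_eval a 0 = 1"
  by (simp add: mono_eval_def)

lemma mono_eval_single [simp]: "mono_eval a (single v k) = a v ^ k"
  by (simp add: mono_eval_def)

lemma mono_eval_add: "mono_eval a (s + t) = mono_eval a s * mono_eval a t"
proof -
  let ?V = "keys s \<union> keys t"
  have "keys (s + t) \<subseteq> ?V" by (rule keys_add)
  then show ?thesis
    by (simp add: mono_eval_superset[of ?V] lookup_add power_add prod.distrib)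
qed

lemma poly_eval_superset:
  assumes "finite T" "keys f \<subseteq> T"
  shows "poly_eval a f = (\<Sum>t\<in>T. lookup f t * mono_eval a t)"
  unfolding poly_eval_def using assms
  by (intro sum.mono_neutral_left) (auto simp: in_keys_iff)

lemma poly_eval_0 [simp]: "poly_eval a 0 = 0"
  by (simp add: poly_eval_def)

lemma poly_eval_single [simp]: "poly_eval a (single t c) = c * mono_eval a t"
  by (simp add: poly_eval_def)

lemma poly_eval_add: "poly_eval a (f + g) = poly_eval a f + poly_eval a g"
proof -
  let ?T = "keys f \<union> keys g"
  have "keys (f + g) \<subseteq> ?T" by (rule keys_add)
  then show ?thesis
    by (simp add: poly_eval_superset[of ?T] lookup_add algebra_simps sum.distrib)
qed

lemma poly_eval_sum: "poly_eval a (\<Sum>i\<in>I. f i) = (\<Sum>i\<in>I. poly_eval a (f i))"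
  by (induction I rule: infinite_finite_induct) (auto simp: poly_eval_add)

lemma poly_eval_mult: "poly_eval a (f * g) = poly_eval a f * poly_eval a g"
proof -
  have "f * g = (\<Sum>s\<in>keys f. \<Sum>t\<in>keys g. single (s + t) (lookup f s * lookup g t))"
    by (subst (1) sum_single_keys[of f, symmetric], subst (1) sum_single_keys[of g, symmetric])
      (simp add: sum_product mult_single)
  then have "poly_eval a (f * g) =
      (\<Sum>s\<in>keys f. \<Sum>t\<in>keys g. lookup f s * lookup g t * (mono_eval a s * mono_eval a t))"
    by (simp add: poly_eval_sum mono_eval_add)
  also have "\<dots> = poly_eval a f * poly_eval a g"
    by (simp add: poly_eval_def sum_product algebra_simps)
  finally show ?thesis .
qed

lemma poly_eval_1 [simp]: "poly_eval a 1 = 1"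
  by (simp add: poly_eval_def)

lemma poly_eval_hom: "comm_ring_hom (poly_eval a)"
  by unfold_locales (auto simp: poly_eval_add poly_eval_mult)

lemma poly_eval_cong:
  assumes "\<And>t v. t \<in> keys f \<Longrightarrow> v \<in> keys t \<Longrightarrow> a v = b v"
  shows "poly_eval a f = poly_eval b f"
  unfolding poly_eval_def mono_eval_def using assms by (intro sum.cong prod.cong refl arg_cong2[where f="(*)"]) auto

lemma poly_eval_prod: "poly_eval a (\<Prod>i\<in>I. f i) = (\<Prod>i\<in>I. poly_eval a (f i))"
  by (induction I rule: infinite_finite_induct) (auto simp: poly_eval_mult)

lemma poly_eval_power: "poly_eval a (f ^ k) = poly_eval a f ^ k"
  by (induction k) (auto simp: poly_eval_mult)

text \<open>The homomorphism from the polynomial ring that acts by \<open>c\<close> on coefficients and sends the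
  variable \<open>v\<close> to \<open>\<phi> v\<close>. Restriction to a line, linear substitution and renaming of variables
  are all obtained from it.\<close>

definition aeval :: "(complex \<Rightarrow> 'b::comm_semiring_1) \<Rightarrow> ('v \<Rightarrow> 'b) \<Rightarrow> 'v cpoly \<Rightarrow> 'b" where
  "aeval c \<phi> f = (\<Sum>t\<in>keys f. c (lookup f t) * (\<Prod>v\<in>keys t. \<phi> v ^ lookup t v))"

lemma poly_eval_aeval:
  "poly_eval x (aeval (single 0) \<phi> f) = poly_eval (\<lambda>v. poly_eval x (\<phi> v)) f"
  by (simp add: aeval_def poly_eval_sum poly_eval_mult poly_eval_prod poly_eval_power
      poly_eval_def[of _ f] mono_eval_def)

definition line_poly :: "('v \<Rightarrow> complex) \<Rightarrow> ('v \<Rightarrow> complex) \<Rightarrow> 'v cpoly \<Rightarrow> complex poly" where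
  "line_poly a b = aeval (\<lambda>c. [:c:]) (\<lambda>v. [:a v, b v:])"

lemma poly_line_poly: "poly (line_poly a b f) t = poly_eval (\<lambda>v. a v + t * b v) f"
  by (simp add: line_poly_def aeval_def poly_sum poly_prod poly_power
      poly_eval_def mono_eval_def)

section \<open>Monomials of given degree\<close>

lemma mono_deg_superset:
  assumes "finite V" "keys t \<subseteq> V"
  shows "mono_deg t = (\<Sum>v\<in>V. lookup t v)"
  unfolding mono_deg_def using assms
  by (intro sum.mono_neutral_left) (auto simp: in_keys_iff)

lemma mono_deg_0 [simp]: "mono_deg 0 = 0"
  by (simp add: mono_deg_def)

lemma mono_deg_single [simp]: "mono_deg (single v k) = k"
  by (simp add: mono_deg_def)

lemma mono_deg_add: "mono_deg (s + t) = mono_deg s + mono_deg t"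
proof -
  let ?V = "keys s \<union> keys t"
  have "keys (s + t) \<subseteq> ?V" by (rule keys_add)
  then show ?thesis
    by (simp add: mono_deg_superset[of ?V] lookup_add sum.distrib)
qed

lemma mono_deg_eq_0_iff: "mono_deg t = 0 \<longleftrightarrow> t = 0"
  unfolding mono_deg_def by (auto simp: in_keys_iff intro: poly_mapping_eqI)

lemma keys_add_nat: "keys (s + t :: 'v monomial) = keys s \<union> keys t"
  by (auto simp: in_keys_iff lookup_add)

lemma monomial_split:
  assumes "v \<in> keys (t :: 'v monomial)"
  shows "t - single v 1 + single v 1 = t"
  using assms by (intro poly_mapping_eqI)
    (auto simp: lookup_add lookup_minus lookup_single when_def in_keys_iff)

text \<open>The set \<open>V\<close> will be \<open>{..m}\<close> for forms on projective space, \<open>{1..m}\<close> for cones whose vertex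
  is the first coordinate point, and \<open>{..<1} \<times> {..m}\<close> for forms in the coordinates of a
  one-element list of points.\<close>

definition monoms :: "'v set \<Rightarrow> nat \<Rightarrow> 'v monomial set" where
  "monoms V e = {t. keys t \<subseteq> V \<and> mono_deg t = e}"

lemma monomials_eq_monoms: "monomials m e = monoms {..m} e"
  by (simp add: monomials_def monoms_def)

lemma monoms_0 [simp]: "monoms V 0 = {0}"
  by (auto simp: monoms_def mono_deg_eq_0_iff)

lemma monoms_empty_Suc [simp]: "monoms {} (Suc e) = {}"
  by (auto simp: monoms_def)

lemma monoms_add: "s \<in> monoms V a \<Longrightarrow> t \<in> monoms V b \<Longrightarrow> s + t \<in> monoms V (a + b)"
  by (simp add: monoms_def keys_add_nat mono_deg_add)

text \<open>Pascal's rule for monomials: either \<open>v\<close> does not occur, or one factor \<open>v\<close> splits off.\<close>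

lemma monoms_insert_Suc:
  assumes "v \<notin> V"
  shows "monoms (insert v V) (Suc e) =
    monoms V (Suc e) \<union> (\<lambda>s. s + single v 1) ` monoms (insert v V) e" (is "?L = ?A \<union> ?B")
proof (rule equalityI; rule subsetI)
  fix t assume t: "t \<in> ?L"
  show "t \<in> ?A \<union> ?B"
  proof (cases "v \<in> keys t")
    case True
    let ?s = "t - single v 1"
    have st: "?s + single v 1 = t" by (rule monomial_split[OF True])
    then have "mono_deg ?s + 1 = mono_deg t" by (metis mono_deg_add mono_deg_single)
    moreover have "keys ?s \<subseteq> keys t" using st by (metis keys_add_nat Un_upper1)
    ultimately have "?s \<in> monoms (insert v V) e" using t by (auto simp: monoms_def)
    then show ?thesis using st by (metis UnI2 image_eqI)
  next
    case False
    then show ?thesis using t by (auto simp: monoms_def)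
  qed
next
  fix t assume "t \<in> ?A \<union> ?B"
  then show "t \<in> ?L" by (auto simp: monoms_def keys_add_nat mono_deg_add split: if_splits)
qed

text \<open>With truncated subtraction the formula covers \<open>V = {}\<close>, where it counts the monomial \<open>1\<close>,
  so the induction can start there.\<close>

lemma finite_card_monoms:
  assumes "finite V"
  shows "finite (monoms V e) \<and> card (monoms V e) = (e + card V - 1) choose e"
  using assms
proof (induction V arbitrary: e rule: finite_induct)
  case empty
  show ?case by (cases e) auto
next
  case (insert v V)
  show ?case
  proof (induction e)
    case 0
    then show ?case by simp
  next
    case (Suc e)
    have disj: "monoms V (Suc e) \<inter> (\<lambda>s. s + single v 1) ` monoms (insert v V) e = {}"
      using insert.hyps by (auto simp: monoms_def keys_add_nat)
    have inj: "inj_on (\<lambda>s. s + single v (1::nat)) A" for A by (rule inj_onI) simp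
    show ?case unfolding monoms_insert_Suc[OF insert.hyps(2)]
      using insert.IH[of "Suc e"] Suc.IH insert.hyps
      by (simp add: card_Un_disjoint[OF _ _ disj] card_image[OF inj] del: One_nat_def)
  qed
qed

lemmas finite_monoms = finite_card_monoms[THEN conjunct1]
lemmas card_monoms = finite_card_monoms[THEN conjunct2]

lemma monoms_1: "monoms V 1 = (\<lambda>v. single v 1) ` V"
proof (rule equalityI; rule subsetI)
  fix t :: "'a monomial" assume t: "t \<in> monoms V 1"
  then have "t \<noteq> 0" by (auto simp: monoms_def)
  then obtain v where v: "v \<in> keys t" by (metis all_not_in_conv keys_eq_empty)
  have st: "t - single v 1 + single v 1 = t" by (rule monomial_split[OF v])
  then have "mono_deg (t - single v 1) + 1 = mono_deg t" by (metis mono_deg_add mono_deg_single)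
  then have "t - single v 1 = 0" using t by (simp add: monoms_def mono_deg_eq_0_iff)
  then have "t = single v 1" using st by simp
  then show "t \<in> (\<lambda>v. single v 1) ` V" using t v by (auto simp: monoms_def)
qed (auto simp: monoms_def)

lemma keys_mult_monoms:
  assumes "keys f \<subseteq> monoms V a" "keys g \<subseteq> monoms V b"
  shows "keys (f * g) \<subseteq> monoms V (a + b)"
  using keys_mult[of f g] assms monoms_add[of _ V a _ b] by blast

lemma keys_sum: "keys (\<Sum>i\<in>I. f i) \<subseteq> (\<Union>i\<in>I. keys (f i))"
proof (induction I rule: infinite_finite_induct)
  case (insert x F)
  then show ?case using keys_add[of "f x" "sum f F"] by auto
qed auto

lemma keys_power_monoms:
  assumes "keys f \<subseteq> monoms V a"
  shows "keys (f ^ k) \<subseteq> monoms V (k * a)"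
  by (induction k) (use keys_mult_monoms[OF assms] in auto)

lemma keys_prod_monoms:
  assumes "\<And>i. i \<in> I \<Longrightarrow> keys (f i) \<subseteq> monoms V (a i)"
  shows "keys (\<Prod>i\<in>I. f i) \<subseteq> monoms V (\<Sum>i\<in>I. a i)"
  using assms
proof (induction I rule: infinite_finite_induct)
  case (insert x F)
  then show ?case using keys_mult_monoms[of "f x" V "a x" "prod f F"] by auto
qed auto

lemma poly_eval_scale:
  assumes "keys f \<subseteq> monoms V d"
  shows "poly_eval (\<lambda>v. c * a v) f = c ^ d * poly_eval a f"
proof -
  have "mono_eval (\<lambda>v. c * a v) t = c ^ mono_deg t * mono_eval a t" for t
    by (simp add: mono_eval_def mono_deg_def power_mult_distrib prod.distrib power_sum)
  then show ?thesis unfolding poly_eval_def sum_distrib_left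
    using assms by (intro sum.cong) (auto simp: monoms_def)
qed

section \<open>Evaluation at points with prime coordinates\<close>

text \<open>A Vandermonde system with distinct nodes has only the zero solution: testing the weights \<open>c\<close>
  against the polynomial that vanishes at all nodes except \<open>z b\<close> isolates \<open>c b\<close>, and this
  polynomial has degree \<open>card A - 1\<close>.\<close>

lemma power_sums_zero:
  fixes z c :: "'a \<Rightarrow> complex"
  assumes fin: "finite A" and inj: "inj_on z A"
    and zero: "\<And>i. i < card A \<Longrightarrow> (\<Sum>a\<in>A. c a * z a ^ i) = 0" and b: "b \<in> A"
  shows "c b = 0"
proof -
  define p where "p = (\<Prod>a\<in>A - {b}. [:- z a, 1:])"
  have "degree p = (\<Sum>a\<in>A - {b}. degree [:- z a, 1:])"
    unfolding p_def by (rule degree_prod_sum_eq) auto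
  then have deg: "degree p = card A - 1" using fin b by simp
  have pos: "card A > 0" using fin b by (auto simp: card_gt_0_iff)
  have root: "poly p (z a) = 0" if "a \<in> A - {b}" for a
    using that fin by (auto simp: p_def poly_prod)
  have nz: "poly p (z b) \<noteq> 0"
    using fin inj b by (auto simp: p_def poly_prod inj_on_def)
  have "0 = (\<Sum>i\<le>degree p. coeff p i * (\<Sum>a\<in>A. c a * z a ^ i))"
    using deg pos zero by (auto intro!: sum.neutral[symmetric])
  also have "\<dots> = (\<Sum>i\<le>degree p. \<Sum>a\<in>A. c a * (coeff p i * z a ^ i))"
    by (simp add: sum_distrib_left algebra_simps)
  also have "\<dots> = (\<Sum>a\<in>A. \<Sum>i\<le>degree p. c a * (coeff p i * z a ^ i))"
    by (rule sum.swap)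
  also have "\<dots> = (\<Sum>a\<in>A. c a * poly p (z a))"
    by (simp add: poly_altdef sum_distrib_left)
  also have "\<dots> = c b * poly p (z b)"
    using fin b root by (subst sum.remove[of A b]) auto
  finally show ?thesis using nz by simp
qed

definition nth_prime :: "nat \<Rightarrow> nat" where
  "nth_prime = enumerate {p. prime p}"

lemma prime_nth_prime: "prime (nth_prime k)"
  using enumerate_in_set[OF primes_infinite, of k] by (simp add: nth_prime_def)

lemma inj_nth_prime: "inj nth_prime"
  unfolding nth_prime_def by (rule strict_mono_imp_inj_on[OF strict_mono_enumerate[OF primes_infinite]])

definition prime_value :: "nat monomial \<Rightarrow> complex" where
  "prime_value = mono_eval (\<lambda>v. of_nat (nth_prime v))"

text \<open>Unique factorization: the value of a monomial at a vector of distinct primes determines all its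
  exponents.\<close>

lemma inj_prime_value: "inj prime_value"
proof (rule injI)
  fix s t assume eq: "prime_value s = prime_value t"
  define N where "N u = (\<Prod>v\<in>keys u. nth_prime v ^ lookup u v)" for u
  have pv: "prime_value u = of_nat (N u)" for u
    by (simp add: prime_value_def mono_eval_def N_def)
  have N: "N s = N t" using eq unfolding pv by simp
  have mult: "multiplicity (nth_prime v) (N u) = lookup u v" for u v
  proof -
    let ?g = "\<lambda>p. lookup u (inv_into UNIV nth_prime p)"
    have "N u = (\<Prod>p\<in>nth_prime ` keys u. p ^ ?g p)"
      unfolding N_def using inj_nth_prime
      by (subst prod.reindex) (auto simp: inj_on_def inv_f_f intro!: prod.cong)
    moreover have "prime p" if "p \<in> nth_prime ` keys u" for p
      using that prime_nth_prime by auto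
    ultimately have "multiplicity (nth_prime v) (N u) = (if nth_prime v \<in> nth_prime ` keys u
        then ?g (nth_prime v) else 0)"
      using multiplicity_prod_prime_powers[of "nth_prime ` keys u" "nth_prime v" ?g]
      by (simp add: prime_nth_prime)
    then show ?thesis using inj_nth_prime
      by (auto simp: inv_f_f inj_image_mem_iff in_keys_iff)
  qed
  show "s = t" by (rule poly_mapping_eqI) (metis mult N)
qed

text \<open>At the vector of \<open>i\<close>-th powers of primes a monomial takes the \<open>i\<close>-th power of its prime value.
  The values of \<open>f\<close> are therefore the power sums of distinct nodes, weighted by the
  coefficients, and as many points as monomials suffice to recover \<open>f\<close>. This yields both the
  identity theorem for polynomials and explicit points that impose independent conditions.\<close>

lemma poly_zero_if_prime_powers:
  assumes "finite T" "keys f \<subseteq> T"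
    and "\<And>i. i < card T \<Longrightarrow> poly_eval (\<lambda>v. of_nat (nth_prime v) ^ i) f = 0"
  shows "f = 0"
proof -
  have "mono_eval (\<lambda>v. of_nat (nth_prime v) ^ i) t = prime_value t ^ i" for i t
    by (simp add: prime_value_def mono_eval_def prod_power_distrib flip: power_mult)
      (simp add: mult.commute)
  then have *: "(\<Sum>t\<in>T. lookup f t * prime_value t ^ i) = 0" if "i < card T" for i
    using assms(3)[OF that] by (simp add: poly_eval_superset[OF assms(1,2)])
  have "lookup f t = 0" if "t \<in> T" for t
    by (rule power_sums_zero[OF assms(1) inj_on_subset[OF inj_prime_value] * that]) auto
  moreover have "lookup f t = 0" if "t \<notin> T" for t
    using that assms(2) by (auto simp: in_keys_iff)
  ultimately show ?thesis by (intro poly_mapping_eqI) auto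
qed

lemma poly_zero_if_eval_zero:
  fixes f :: "nat cpoly"
  assumes "\<And>a. poly_eval a f = 0"
  shows "f = 0"
  by (rule poly_zero_if_prime_powers[of "keys f"]) (use assms in auto)

section \<open>Directional derivatives\<close>

definition dir_deriv :: "nat \<Rightarrow> (nat \<Rightarrow> complex) \<Rightarrow> nat cpoly \<Rightarrow> nat cpoly" where
  "dir_deriv m q f = (\<Sum>l\<le>m. single 0 (q l) * pderiv_var l f)"

lemma lookup_const_mult: "lookup (single 0 c * f) t = c * lookup f t"
proof -
  have "lookup (Poly_Mapping.map ((*) c) f) t = c * lookup f t"
    by (transfer fixing: c) (simp add: when_def)
  then show ?thesis by (simp add: mult_map_scale_conv_mult)
qed

lemma lookup_pderiv_var:
  "lookup (pderiv_var i f) t = of_nat (lookup t i + 1) * lookup f (t + single i 1)"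
proof -
  let ?u = "t + single i (1::nat)"
  \<comment> \<open>Subtraction of exponents is truncated, so \<open>t - e\<^sub>i = t\<close> if \<open>x\<^sub>i\<close> does not occur in \<open>t\<close>; such terms carry the factor \<open>0\<close>.\<close>
  have *: "(of_nat (lookup u i) * lookup f u when u - single i 1 = t) =
      (of_nat (lookup t i + 1) * lookup f ?u when u = ?u)" for u
  proof (cases "lookup u i = 0")
    case True
    then have "u \<noteq> ?u" by (auto simp: lookup_add)
    then show ?thesis using True by simp
  next
    case False
    then have "u - single i 1 + single i 1 = u" by (intro monomial_split) (simp add: in_keys_iff)
    then have "u - single i 1 = t \<longleftrightarrow> u = ?u" by (metis add_diff_cancel_right')
    then show ?thesis by (auto simp: when_def lookup_add)
  qed
  have "lookup (pderiv_var i f) t =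
      (\<Sum>u\<in>keys f. of_nat (lookup u i) * lookup f u when u - single i 1 = t)"
    by (simp add: pderiv_var_def lookup_sum lookup_single)
  also have "\<dots> = (\<Sum>u\<in>keys f. of_nat (lookup t i + 1) * lookup f ?u when u = ?u)"
    by (simp only: *)
  also have "\<dots> = of_nat (lookup t i + 1) * lookup f ?u"
    by (auto simp: when_def sum.delta in_keys_iff)
  finally show ?thesis .
qed

lemma lookup_pderiv_var_power:
  "lookup ((pderiv_var i ^^ k) f) t = pochhammer (of_nat (lookup t i + 1)) k * lookup f (t + single i k)"
proof (induction k arbitrary: t)
  case (Suc k)
  have "t + single i 1 + single i k = t + single i (Suc k)"
    by (simp add: add.assoc flip: single_add)
  then show ?case
    by (simp add: lookup_pderiv_var Suc lookup_add pochhammer_rec algebra_simps)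
qed simp

lemma lookup_dir_deriv:
  "lookup (dir_deriv m q f) t =
    (\<Sum>l\<le>m. q l * (of_nat (lookup t l + 1) * lookup f (t + single l 1)))"
  by (simp add: dir_deriv_def lookup_sum lookup_const_mult lookup_pderiv_var)

lemma keys_dir_deriv:
  assumes "keys f \<subseteq> monomials m (Suc e)"
  shows "keys (dir_deriv m q f) \<subseteq> monomials m e"
proof
  fix t assume "t \<in> keys (dir_deriv m q f)"
  then have "(\<Sum>l\<le>m. q l * (of_nat (lookup t l + 1) * lookup f (t + single l 1))) \<noteq> 0"
    by (simp add: in_keys_iff lookup_dir_deriv)
  then obtain l where "lookup f (t + single l 1) \<noteq> 0"
    by (metis (no_types, lifting) mult_zero_right sum.neutral)
  then have "t + single l 1 \<in> monomials m (Suc e)" using assms by (auto simp: in_keys_iff)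
  then show "t \<in> monomials m e"
    by (auto simp: monomials_def keys_add_nat mono_deg_add)
qed

lemma mono_eval_diff_single:
  assumes "finite V" "keys t \<subseteq> V" "l \<in> V"
  shows "mono_eval a (t - single l 1) = (\<Prod>v\<in>V - {l}. a v ^ lookup t v) * a l ^ (lookup t l - 1)"
proof -
  have "keys (t - single l 1) \<subseteq> V" using assms(2) by (auto simp: in_keys_iff lookup_minus)
  then show ?thesis
    unfolding mono_eval_superset[OF assms(1) \<open>keys (t - single l 1) \<subseteq> V\<close>]
      prod.remove[OF assms(1,3)]
    by (auto simp: lookup_minus lookup_single when_def mult.commute intro!: arg_cong2[where f="(*)"] prod.cong)
qed

lemma pderiv_sum: "pderiv (\<Sum>i\<in>I. f i) = (\<Sum>i\<in>I. pderiv (f i))"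
  by (induction I rule: infinite_finite_induct) (auto simp: pderiv_add)

text \<open>The chain rule along the line through \<open>a\<close> in direction \<open>b\<close>.\<close>

lemma poly_pderiv_line_poly:
  assumes "\<And>t. t \<in> keys f \<Longrightarrow> keys t \<subseteq> {..m}"
  shows "poly (pderiv (line_poly a b f)) x = poly_eval (\<lambda>v. a v + x * b v) (dir_deriv m b f)"
proof -
  let ?y = "\<lambda>v. a v + x * b v"
  have line: "line_poly a b f = (\<Sum>t\<in>keys f. Polynomial.smult (lookup f t) (\<Prod>v\<le>m. [:a v, b v:] ^ lookup t v))"
    unfolding line_poly_def aeval_def
  proof (intro sum.cong refl)
    fix t assume "t \<in> keys f"
    then have "(\<Prod>v\<in>keys t. [:a v, b v:] ^ lookup t v) = (\<Prod>v\<le>m. [:a v, b v:] ^ lookup t v)"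
      using assms by (intro prod.mono_neutral_left) (auto simp: in_keys_iff)
    then show "[:lookup f t:] * (\<Prod>v\<in>keys t. [:a v, b v:] ^ lookup t v) =
        Polynomial.smult (lookup f t) (\<Prod>v\<le>m. [:a v, b v:] ^ lookup t v)" by simp
  qed
  have "poly (pderiv (line_poly a b f)) x =
      (\<Sum>t\<in>keys f. \<Sum>l\<le>m. lookup f t * ((\<Prod>v\<in>{..m} - {l}. ?y v ^ lookup t v) *
        (of_nat (lookup t l) * ?y l ^ (lookup t l - 1) * b l)))"
    unfolding line
    by (simp add: pderiv_sum pderiv_smult pderiv_prod poly_sum poly_prod poly_power
        pderiv_power pderiv_pCons sum_distrib_left mult_ac)
  also have "\<dots> = (\<Sum>l\<le>m. \<Sum>t\<in>keys f. lookup f t * ((\<Prod>v\<in>{..m} - {l}. ?y v ^ lookup t v) *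
        (of_nat (lookup t l) * ?y l ^ (lookup t l - 1) * b l)))"
    by (rule sum.swap)
  also have "\<dots> = (\<Sum>l\<le>m. b l * (\<Sum>t\<in>keys f. of_nat (lookup t l) * lookup f t *
      mono_eval ?y (t - single l 1)))"
    unfolding sum_distrib_left
    using assms by (intro sum.cong refl) (simp add: mono_eval_diff_single[of "{..m}"] del: One_nat_def)
  also have "\<dots> = poly_eval ?y (dir_deriv m b f)"
    by (simp add: dir_deriv_def poly_eval_sum poly_eval_mult pderiv_var_def)
  finally show ?thesis .
qed

text \<open>Polynomials that are constant along all lines in direction \<open>b\<close> are those with vanishing
  derivative in this direction; on each line this is the statement for one variable.\<close>

lemma dir_deriv_eq_0_iff:
  assumes f: "\<And>t. t \<in> keys f \<Longrightarrow> keys t \<subseteq> {..m}"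
  shows "dir_deriv m b f = 0 \<longleftrightarrow> (\<forall>a x. poly_eval (\<lambda>v. a v + x * b v) f = poly_eval a f)"
proof (intro iffI allI)
  fix a x assume "dir_deriv m b f = 0"
  then have "pderiv (line_poly a b f) = 0"
    by (intro poly_all_0_iff_0[THEN iffD1]) (simp add: poly_pderiv_line_poly[OF f])
  then obtain c where "line_poly a b f = [:c:]"
    by (metis pderiv_eq_0_iff degree_eq_zeroE)
  then have "poly (line_poly a b f) x = poly (line_poly a b f) 0" by simp
  then show "poly_eval (\<lambda>v. a v + x * b v) f = poly_eval a f"
    by (simp add: poly_line_poly)
next
  assume const: "\<forall>a x. poly_eval (\<lambda>v. a v + x * b v) f = poly_eval a f"
  show "dir_deriv m b f = 0"
  proof (rule poly_zero_if_eval_zero)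
    fix a
    have "poly (line_poly a b f) = poly [:poly_eval a f:]"
      using const by (intro ext) (simp add: poly_line_poly)
    then have "line_poly a b f = [:poly_eval a f:]" by (simp only: poly_eq_poly_eq_iff)
    then have "poly (pderiv (line_poly a b f)) 0 = 0" by (simp add: pderiv_pCons)
    then show "poly_eval a (dir_deriv m b f) = 0" by (simp add: poly_pderiv_line_poly[OF f])
  qed
qed

lemma lookup_fold_pderiv:
  assumes "distinct is"
  shows "lookup (fold (\<lambda>i. pderiv_var i ^^ lookup s i) is f) t =
    (\<Prod>i\<in>set is. pochhammer (of_nat (lookup t i + 1)) (lookup s i)) *
      lookup f (t + (\<Sum>i\<in>set is. single i (lookup s i)))"
  using assms
proof (induction "is" arbitrary: f)
  case (Cons i js)
  have notin: "i \<notin> set js" using Cons.prems by simp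
  have "lookup (t + (\<Sum>i\<in>set js. single i (lookup s i))) i = lookup t i"
    using notin by (auto simp: lookup_add lookup_sum lookup_single when_def sum.delta)
  then show ?case using Cons notin
    by (simp add: lookup_pderiv_var_power algebra_simps)
qed simp

text \<open>The product is the multi-index quotient \<open>(t + s)! / t!\<close>. Reading the coefficient at \<open>t\<close> rather
  than differentiating monomials avoids a case distinction on divisibility.\<close>

lemma lookup_diff_op:
  assumes "keys s \<subseteq> {..m}"
  shows "lookup (diff_op m s f) t =
    (\<Prod>i\<le>m. pochhammer (of_nat (lookup t i + 1)) (lookup s i)) * lookup f (t + s)"
proof -
  have set: "set [0..<m + 1] = {..m}" by auto
  have "(\<Sum>i\<le>m. single i (lookup s i)) = s"
    using assms by (intro poly_mapping_eqI)
      (auto simp: lookup_sum lookup_single when_def sum.delta in_keys_iff)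
  then show ?thesis
    using lookup_fold_pderiv[of "[0..<m + 1]" s f t] unfolding diff_op_def set by simp
qed

lemma keys_diff_op:
  assumes f: "keys f \<subseteq> monomials m (Suc e)" and s: "s \<in> monomials m e"
  shows "keys (diff_op m s f) \<subseteq> monomials m 1"
proof
  fix t assume "t \<in> keys (diff_op m s f)"
  moreover have "keys s \<subseteq> {..m}" using s by (simp add: monomials_def)
  ultimately have "t + s \<in> keys f" by (auto simp: in_keys_iff lookup_diff_op)
  then have "t + s \<in> monomials m (Suc e)" using f by auto
  then show "t \<in> monomials m 1" using s
    by (auto simp: monomials_def keys_add_nat mono_deg_add)
qed

lemma pochhammer_two: "pochhammer (2 :: complex) k = fact k * (of_nat k + 1)"
  using pochhammer_rec[of "1 :: complex" k] pochhammer_fact[of "Suc k", where 'a = complex]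
  by (simp add: algebra_simps)

definition mono_fact :: "nat \<Rightarrow> nat monomial \<Rightarrow> complex" where
  "mono_fact m s = (\<Prod>i\<le>m. fact (lookup s i))"

lemma mono_fact_nonzero: "mono_fact m s \<noteq> 0"
  by (simp add: mono_fact_def)

text \<open>This identity explains the derivative rows of the interpolation matrix. For a form \<open>f\<close> of degree
  \<open>e + 1\<close> and \<open>s\<close> of degree \<open>e\<close>, the derivative of \<open>f\<close> by \<open>s\<close> is a linear form whose coefficient
  at the variable \<open>l\<close> is \<open>s! (s\<^sub>l + 1)\<close> times the coefficient of \<open>f\<close> at \<open>s + e\<^sub>l\<close>. Its value at \<open>q\<close>
  is thus \<open>s!\<close> times a coefficient of the derivative of \<open>f\<close> in direction \<open>q\<close>.\<close>

lemma poly_eval_diff_op: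
  assumes f: "keys f \<subseteq> monomials m (Suc e)" and s: "s \<in> monomials m e"
  shows "poly_eval q (diff_op m s f) = mono_fact m s * lookup (dir_deriv m q f) s"
proof -
  have ks: "keys s \<subseteq> {..m}" using s by (simp add: monomials_def)
  have poch: "(\<Prod>i\<le>m. pochhammer (of_nat (lookup (single l 1) i + 1)) (lookup s i)) =
      mono_fact m s * of_nat (lookup s l + 1)" if l: "l \<le> m" for l
  proof -
    have "(\<Prod>i\<le>m. pochhammer (of_nat (lookup (single l 1) i + 1)) (lookup s i)) =
        (\<Prod>i\<le>m. fact (lookup s i) * (if i = l then of_nat (lookup s l + 1) else 1 :: complex))"
      by (intro prod.cong refl)
        (auto simp: lookup_single when_def pochhammer_two pochhammer_fact[symmetric])
    also have "\<dots> = mono_fact m s * of_nat (lookup s l + 1)"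
      using l by (simp add: prod.distrib mono_fact_def prod.delta)
    finally show ?thesis .
  qed
  have inj: "inj_on (\<lambda>l. single l (1::nat)) A" for A
    by (rule inj_onI) (metis lookup_single_eq lookup_single_not_eq zero_neq_one)
  have "poly_eval q (diff_op m s f) =
      (\<Sum>t\<in>monomials m 1. lookup (diff_op m s f) t * mono_eval q t)"
    using keys_diff_op[OF f s] by (intro poly_eval_superset)
      (auto simp: monomials_eq_monoms intro: finite_monoms)
  also have "\<dots> = (\<Sum>l\<le>m. lookup (diff_op m s f) (single l 1) * q l)"
    unfolding monomials_eq_monoms monoms_1 by (subst sum.reindex[OF inj]) simp
  also have "\<dots> = (\<Sum>l\<le>m. mono_fact m s * of_nat (lookup s l + 1) * lookup f (s + single l 1) * q l)"
    by (intro sum.cong refl) (simp only: lookup_diff_op[OF ks] poch atMost_iff add.commute[of _ s])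
  also have "\<dots> = mono_fact m s * lookup (dir_deriv m q f) s"
    by (simp add: lookup_dir_deriv sum_distrib_left mult_ac)
  finally show ?thesis .
qed

section \<open>The kernel of the interpolation matrix\<close>

lemma variable_le:
  assumes "keys f \<subseteq> monomials m d" "t \<in> keys f" "v \<in> keys t"
  shows "v \<le> m"
  using assms by (auto simp: monomials_def)

text \<open>A form whose derivative in direction \<open>q\<close> vanishes is constant in this direction: it defines a
  cone with vertex \<open>q\<close>.\<close>

definition has_cone :: "nat \<Rightarrow> nat \<Rightarrow> complex vec \<Rightarrow> complex vec set \<Rightarrow> bool" where
  "has_cone m d q S \<longleftrightarrow> (\<exists>f. is_form m d f \<and> (\<forall>v\<in>S. poly_eval (\<lambda>j. v $ j) f = 0) \<and>
     dir_deriv m (\<lambda>j. q $ j) f = 0)"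

lemma finite_monomials [simp]: "finite (monomials m e)"
  by (simp add: monomials_eq_monoms finite_monoms)

lemma set_monomial_list [simp]: "set (monomial_list m e) = monomials m e"
  by (simp add: monomial_list_def)

lemma distinct_monomial_list [simp]: "distinct (monomial_list m e)"
  by (simp add: monomial_list_def)

lemma length_monomial_list [simp]: "length (monomial_list m e) = card (monomials m e)"
  by (simp add: monomial_list_def)

lemma monomial_list_nth_mem: "j < card (monomials m e) \<Longrightarrow> monomial_list m e ! j \<in> monomials m e"
  using nth_mem[of j "monomial_list m e"] by simp

lemma sum_monomial_list:
  "(\<Sum>j = 0..<card (monomials m e). g (monomial_list m e ! j)) = (\<Sum>t\<in>monomials m e. g t)"
proof -
  have "bij_betw ((!) (monomial_list m e)) {0..<card (monomials m e)} (monomials m e)"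
    using bij_betw_nth[of "monomial_list m e" "{..<length (monomial_list m e)}"]
    by (simp add: atLeast0LessThan)
  then show ?thesis by (rule sum.reindex_bij_betw)
qed

lemma interpolation_matrix_carrier:
  "interpolation_matrix m d vs \<in>
     carrier_mat (length vs + card (monomials m (d - 1))) (card (monomials m d))"
  by (simp add: interpolation_matrix_def Let_def)

lemma interpolation_matrix_index:
  assumes "i < length vs + card (monomials m (d - 1))" "j < card (monomials m d)"
  shows "interpolation_matrix m d vs $$ (i, j) =
    (if i < length vs then single 0 (mono_eval (\<lambda>k. (vs ! i) $ k) (monomial_list m d ! j))
     else diff_op m (monomial_list m (d - 1) ! (i - length vs)) (single (monomial_list m d ! j) 1))"
  using assms by (simp add: interpolation_matrix_def Let_def)

definition coeff_vec :: "nat \<Rightarrow> nat \<Rightarrow> nat cpoly \<Rightarrow> complex vec" where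
  "coeff_vec m d f = vec (card (monomials m d)) (\<lambda>j. lookup f (monomial_list m d ! j))"

lemma coeff_vec_surj:
  assumes "v \<in> carrier_vec (card (monomials m d))"
  obtains f where "keys f \<subseteq> monomials m d" "coeff_vec m d f = v"
proof
  let ?cs = "monomial_list m d" and ?N = "card (monomials m d)"
  let ?f = "\<Sum>j = 0..<?N. single (?cs ! j) (v $ j)"
  show "keys ?f \<subseteq> monomials m d"
  proof
    fix t assume "t \<in> keys ?f"
    then obtain j where "j < ?N" "t \<in> keys (single (?cs ! j) (v $ j))"
      using keys_sum[of "\<lambda>j. single (?cs ! j) (v $ j)" "{0..<?N}"] by auto
    then show "t \<in> monomials m d" by (auto simp: monomial_list_nth_mem split: if_splits)
  qed
  have "lookup ?f (?cs ! i) = v $ i" if i: "i < ?N" for i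
  proof -
    have "lookup ?f (?cs ! i) = (\<Sum>j = 0..<?N. v $ j when ?cs ! j = ?cs ! i)"
      by (simp add: lookup_sum lookup_single)
    also have "\<dots> = (\<Sum>j = 0..<?N. v $ j when j = i)"
      using i by (intro sum.cong refl) (simp add: nth_eq_iff_index_eq)
    finally show ?thesis using i by (simp add: when_def sum.delta)
  qed
  then show "coeff_vec m d ?f = v"
    using assms by (intro eq_vecI) (auto simp: coeff_vec_def)
qed

lemma coeff_vec_eq_0_iff:
  assumes "keys f \<subseteq> monomials m d"
  shows "coeff_vec m d f = 0\<^sub>v (card (monomials m d)) \<longleftrightarrow> f = 0"
proof
  assume z: "coeff_vec m d f = 0\<^sub>v (card (monomials m d))"
  have "lookup f t = 0" if "t \<in> monomials m d" for t
  proof -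
    have "t \<in> set (monomial_list m d)" using that by simp
    then obtain j where "j < card (monomials m d)" "t = monomial_list m d ! j"
      unfolding in_set_conv_nth by auto
    then show ?thesis
      using arg_cong[OF z, of "\<lambda>v. v $ j"] by (simp add: coeff_vec_def)
  qed
  then show "f = 0" using assms by (intro poly_mapping_eqI) (auto simp: in_keys_iff)
qed (auto simp: coeff_vec_def)

lemma dir_deriv_single_sum:
  assumes f: "keys f \<subseteq> T" "finite T"
  shows "(\<Sum>t\<in>T. lookup (dir_deriv m q (single t 1)) s * lookup f t) = lookup (dir_deriv m q f) s"
proof -
  have f_eq: "(\<Sum>t\<in>T. lookup (single t 1) u * lookup f t) = lookup f u" for u
    using f by (auto simp: lookup_single when_def if_distrib[of "\<lambda>x. x * _"] sum.delta
        in_keys_iff cong: if_cong)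
  have "(\<Sum>t\<in>T. lookup (dir_deriv m q (single t 1)) s * lookup f t) =
      (\<Sum>l\<le>m. \<Sum>t\<in>T. q l * (of_nat (lookup s l + 1)) *
         (lookup (single t 1) (s + single l 1) * lookup f t))"
    by (subst sum.swap) (simp add: lookup_dir_deriv sum_distrib_right sum_distrib_left mult_ac)
  also have "\<dots> = lookup (dir_deriv m q f) s"
    by (simp only: f_eq flip: sum_distrib_left) (simp add: lookup_dir_deriv mult_ac)
  finally show ?thesis .
qed

text \<open>The rows of the points evaluate a form; the derivative rows give, up to nonzero factorials, the
  coefficients of its derivative in direction \<open>q\<close>.\<close>

lemma interpolation_matrix_mult_coeff_vec:
  assumes f: "keys f \<subseteq> monomials m (Suc e)" and i: "i < length vs + card (monomials m e)"
  shows "(matrix_at (interpolation_matrix m (Suc e) vs) q *\<^sub>v coeff_vec m (Suc e) f) $ i =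
    (if i < length vs then poly_eval (\<lambda>j. (vs ! i) $ j) f
     else mono_fact m (monomial_list m e ! (i - length vs)) *
       lookup (dir_deriv m (\<lambda>j. q $ j) f) (monomial_list m e ! (i - length vs)))"
proof -
  let ?A = "interpolation_matrix m (Suc e) vs" and ?d = "Suc e"
  let ?g = "\<lambda>t. if i < length vs then mono_eval (\<lambda>k. (vs ! i) $ k) t
    else poly_eval (\<lambda>j. q $ j) (diff_op m (monomial_list m e ! (i - length vs)) (single t 1))"
  have A: "?A \<in> carrier_mat (length vs + card (monomials m e)) (card (monomials m ?d))"
    using interpolation_matrix_carrier[of m ?d vs] by simp
  have "(matrix_at ?A q *\<^sub>v coeff_vec m ?d f) $ i =
      (\<Sum>j = 0..<card (monomials m ?d). ?g (monomial_list m ?d ! j) * lookup f (monomial_list m ?d ! j))"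
    using i A by (auto simp: matrix_at_def scalar_prod_def coeff_vec_def interpolation_matrix_index
        intro!: sum.cong)
  also have "\<dots> = (\<Sum>t\<in>monomials m ?d. ?g t * lookup f t)"
    by (rule sum_monomial_list)
  also have "\<dots> = (if i < length vs then poly_eval (\<lambda>j. (vs ! i) $ j) f
     else mono_fact m (monomial_list m e ! (i - length vs)) *
       lookup (dir_deriv m (\<lambda>j. q $ j) f) (monomial_list m e ! (i - length vs)))"
  proof (cases "i < length vs")
    case True
    then show ?thesis
      by (simp add: poly_eval_superset[OF finite_monomials f] mult.commute)
  next
    case False
    let ?s = "monomial_list m e ! (i - length vs)"
    have s: "?s \<in> monomials m e" using False i by (intro monomial_list_nth_mem) auto
    have "(\<Sum>t\<in>monomials m ?d. ?g t * lookup f t) = mono_fact m ?s *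
        (\<Sum>t\<in>monomials m ?d. lookup (dir_deriv m (\<lambda>j. q $ j) (single t 1)) ?s * lookup f t)"
      unfolding sum_distrib_left using False
      by (intro sum.cong refl) (simp add: poly_eval_diff_op[OF _ s])
    then show ?thesis using False
      by (simp add: dir_deriv_single_sum[OF f])
  qed
  finally show ?thesis .
qed

text \<open>The kernel of the matrix at \<open>q\<close> consists of the coefficient vectors of the cones with vertex
  \<open>q\<close> through the points, so in the square case the determinant detects such cones.\<close>

lemma det_interpolation_matrix_eq_0_iff:
  assumes square: "length vs + card (monomials m e) = card (monomials m (Suc e))"
  shows "det (matrix_at (interpolation_matrix m (Suc e) vs) q) = 0 \<longleftrightarrow>
    has_cone m (Suc e) q (set vs)"
proof -
  let ?d = "Suc e" and ?N = "card (monomials m (Suc e))"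
  let ?A = "matrix_at (interpolation_matrix m ?d vs) q"
  have A: "?A \<in> carrier_mat ?N ?N"
    using interpolation_matrix_carrier[of m ?d vs] square by (simp add: matrix_at_def)
  have kernel: "?A *\<^sub>v coeff_vec m ?d f = 0\<^sub>v ?N \<longleftrightarrow>
      (\<forall>v\<in>set vs. poly_eval (\<lambda>j. v $ j) f = 0) \<and> dir_deriv m (\<lambda>j. q $ j) f = 0"
    if f: "keys f \<subseteq> monomials m ?d" for f
  proof -
    let ?D = "dir_deriv m (\<lambda>j. q $ j) f"
    let ?E = "\<lambda>i. (?A *\<^sub>v coeff_vec m ?d f) $ i"
    have row: "?E i = (if i < length vs then poly_eval (\<lambda>j. (vs ! i) $ j) f
       else mono_fact m (monomial_list m e ! (i - length vs)) *
         lookup ?D (monomial_list m e ! (i - length vs)))" if "i < ?N" for i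
      using that square by (intro interpolation_matrix_mult_coeff_vec[OF f]) simp
    have "?A *\<^sub>v coeff_vec m ?d f = 0\<^sub>v ?N \<longleftrightarrow> (\<forall>i<?N. ?E i = 0)"
      using A by (auto simp: vec_eq_iff)
    also have "\<dots> \<longleftrightarrow> (\<forall>i<length vs. ?E i = 0) \<and> (\<forall>k<card (monomials m e). ?E (length vs + k) = 0)"
    proof -
      have "i < ?N \<longleftrightarrow> i < length vs \<or> (\<exists>k<card (monomials m e). i = length vs + k)" for i
        unfolding square[symmetric] by presburger
      then show ?thesis by blast
    qed
    also have "(\<forall>i<length vs. ?E i = 0) \<longleftrightarrow> (\<forall>v\<in>set vs. poly_eval (\<lambda>j. v $ j) f = 0)"
      using row square by (simp add: all_set_conv_all_nth)
    also have "(\<forall>k<card (monomials m e). ?E (length vs + k) = 0) \<longleftrightarrow> (\<forall>s\<in>monomials m e. lookup ?D s = 0)"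
      using row square mono_fact_nonzero
        all_set_conv_all_nth[of "monomial_list m e" "\<lambda>s. lookup ?D s = 0"]
      by simp
    also have "\<dots> \<longleftrightarrow> ?D = 0"
      using keys_dir_deriv[OF f, of "\<lambda>j. q $ j"]
      by (auto simp: subset_iff in_keys_iff intro!: poly_mapping_eqI)
    finally show ?thesis .
  qed
  show ?thesis
  proof
    assume "det ?A = 0"
    then obtain v where v: "v \<in> carrier_vec ?N" "v \<noteq> 0\<^sub>v ?N" "?A *\<^sub>v v = 0\<^sub>v ?N"
      using det_0_iff_vec_prod_zero_field[OF A] by auto
    obtain f where f: "keys f \<subseteq> monomials m ?d" "coeff_vec m ?d f = v"
      using coeff_vec_surj[OF v(1)] .
    then have "f \<noteq> 0" using v(2) coeff_vec_eq_0_iff[OF f(1)] by auto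
    then show "has_cone m ?d q (set vs)"
      using kernel[OF f(1)] f v(3) unfolding has_cone_def is_form_def by metis
  next
    assume "has_cone m ?d q (set vs)"
    then obtain f where f: "f \<noteq> 0" "keys f \<subseteq> monomials m ?d"
        "\<forall>v\<in>set vs. poly_eval (\<lambda>j. v $ j) f = 0" "dir_deriv m (\<lambda>j. q $ j) f = 0"
      by (auto simp: has_cone_def is_form_def)
    have "coeff_vec m ?d f \<in> carrier_vec ?N" by (simp add: coeff_vec_def)
    then show "det ?A = 0"
      using kernel[OF f(2)] f coeff_vec_eq_0_iff[OF f(2)] det_0_iff_vec_prod_zero_field[OF A] by blast
  qed
qed

lemma has_cone_rescale:
  assumes "\<And>v. v \<in> S \<Longrightarrow> \<exists>c w. w \<in> S' \<and> v = c \<cdot>\<^sub>v w" "\<And>v. v \<in> S \<Longrightarrow> v \<in> carrier_vec (m + 1)"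
    and "has_cone m d q S'"
  shows "has_cone m d q S"
proof -
  obtain f where f: "is_form m d f" "\<forall>v\<in>S'. poly_eval (\<lambda>j. v $ j) f = 0"
      "dir_deriv m (\<lambda>j. q $ j) f = 0"
    using assms(3) by (auto simp: has_cone_def)
  have kf: "keys f \<subseteq> monoms {..m} d" using f(1) by (simp add: is_form_def monomials_eq_monoms)
  have "poly_eval (\<lambda>j. v $ j) f = 0" if v: "v \<in> S" for v
  proof -
    obtain c w where w: "w \<in> S'" "v = c \<cdot>\<^sub>v w" using assms(1)[OF v] by auto
    have "dim_vec w = m + 1" using w assms(2)[OF v] by auto
    then have "poly_eval (\<lambda>j. v $ j) f = poly_eval (\<lambda>j. c * w $ j) f"
      using variable_le[OF kf[folded monomials_eq_monoms]] w
      by (intro poly_eval_cong) (simp add: le_imp_less_Suc)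
    then show ?thesis using poly_eval_scale[OF kf] f(2) w by simp
  qed
  then show ?thesis using f by (auto simp: has_cone_def)
qed

section \<open>A vertex and points without a cone\<close>

definition prime_point :: "nat \<Rightarrow> nat \<Rightarrow> complex vec" where
  "prime_point m i = vec (m + 1) (\<lambda>v. of_nat (nth_prime v) ^ i)"

text \<open>A cone whose vertex is the first coordinate point is a form in the remaining \<open>m\<close> variables.
  There are as many points as monomials of this kind, and the powers of a prime vector impose
  independent conditions on them.\<close>

lemma no_cone_prime_points:
  "\<not> has_cone m (Suc e) (unit_vec (m + 1) 0) (prime_point m ` {..<card (monoms {1..m} (Suc e))})"
proof
  let ?T = "monoms {1..m} (Suc e)" and ?q = "\<lambda>j. unit_vec (m + 1) 0 $ j :: complex"
  assume "has_cone m (Suc e) (unit_vec (m + 1) 0) (prime_point m ` {..<card ?T})"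
  then obtain f where f: "f \<noteq> 0" "keys f \<subseteq> monomials m (Suc e)" "dir_deriv m ?q f = 0"
      and zero: "\<forall>i<card ?T. poly_eval (\<lambda>j. prime_point m i $ j) f = 0"
    by (auto simp: has_cone_def is_form_def)
  have "keys f \<subseteq> ?T"
  proof
    fix t assume t: "t \<in> keys f"
    have "0 \<notin> keys t"
    proof
      assume t0: "0 \<in> keys t"
      \<comment> \<open>A monomial of \<open>f\<close> that contains \<open>x\<^sub>0\<close> would survive in the derivative by \<open>x\<^sub>0\<close>.\<close>
      let ?s = "t - single 0 1"
      have st: "?s + single 0 1 = t" by (rule monomial_split[OF t0])
      have "0 = lookup (dir_deriv m ?q f) ?s" using f(3) by simp
      also have "\<dots> = (\<Sum>l\<in>{0}. ?q l * (of_nat (lookup ?s l + 1) * lookup f (?s + single l 1)))"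
        unfolding lookup_dir_deriv by (rule sum.mono_neutral_right) auto
      also have "\<dots> = of_nat (lookup ?s 0 + 1) * lookup f t" using st by simp
      finally have "of_nat (lookup ?s 0 + 1) * lookup f t = 0" by simp
      then show False using t by (simp only: mult_eq_0_iff of_nat_eq_0_iff in_keys_iff) simp
    qed
    then have "keys t \<subseteq> {1..m}" using variable_le[OF f(2) t]
      by (auto simp: Suc_le_eq intro!: Nat.gr0I)
    then show "t \<in> ?T" using t f(2) by (auto simp: monomials_def monoms_def)
  qed
  moreover have "poly_eval (\<lambda>v. of_nat (nth_prime v) ^ i) f = 0" if "i < card ?T" for i
  proof -
    have "poly_eval (\<lambda>v. of_nat (nth_prime v) ^ i) f = poly_eval (\<lambda>j. prime_point m i $ j) f"
      using variable_le[OF f(2)]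
      by (intro poly_eval_cong) (simp add: prime_point_def le_imp_less_Suc)
    then show ?thesis using zero that by simp
  qed
  ultimately have "f = 0"
    by (intro poly_zero_if_prime_powers[of ?T]) (auto intro: finite_monoms)
  then show False using f(1) by simp
qed

section \<open>Determinants of matrices of polynomials\<close>

lemma keys_prod:
  fixes f :: "'i \<Rightarrow> 'v cpoly"
  assumes "finite I" "t \<in> keys (\<Prod>i\<in>I. f i)"
  shows "\<exists>s. (\<forall>i\<in>I. s i \<in> keys (f i)) \<and> t = (\<Sum>i\<in>I. s i)"
  using assms
proof (induction I arbitrary: t rule: finite_induct)
  case (insert x I)
  from insert.prems insert.hyps have "t \<in> keys (f x * prod f I)" by simp
  then obtain a b where ab: "a \<in> keys (f x)" "b \<in> keys (prod f I)" "t = a + b"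
    using keys_mult by blast
  then obtain s where s: "\<forall>i\<in>I. s i \<in> keys (f i)" "b = (\<Sum>i\<in>I. s i)"
    using insert.IH by blast
  have "sum (s(x := a)) I = sum s I" using insert.hyps by (intro sum.cong) auto
  then show ?case using ab s insert.hyps
    by (intro exI[of _ "s(x := a)"]) auto
qed auto

text \<open>By the Leibniz formula a monomial of the determinant is a product of monomials of entries, one
  from each row. Homogeneity in any grading can therefore be read off the rows.\<close>

lemma keys_det:
  fixes A :: "'v cpoly mat"
  assumes A: "A \<in> carrier_mat n n" and t: "t \<in> keys (det A)"
  shows "\<exists>p s. p permutes {..<n} \<and> (\<forall>i<n. s i \<in> keys (A $$ (i, p i))) \<and> t = (\<Sum>i<n. s i)"
proof -
  let ?P = "\<lambda>p. \<Prod>i = 0..<n. A $$ (i, p i)"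
  have "t \<in> keys (\<Sum>p | p permutes {0..<n}. signof p * ?P p)"
    using t unfolding det_def'[OF A] .
  then obtain p where p: "p permutes {0..<n}" "t \<in> keys (signof p * ?P p)"
    using keys_sum[of "\<lambda>p. signof p * ?P p" "{p. p permutes {0..<n}}"] by auto
  have "t \<in> keys (?P p)"
    using p(2) by (cases p rule: sign_cases) (auto simp: in_keys_iff)
  then show ?thesis
    using keys_prod[of "{0..<n}" t "\<lambda>i. A $$ (i, p i)"] p(1)
    by (auto simp: atLeast0LessThan)
qed

lemma sum_monoms:
  assumes "\<And>i. i \<in> I \<Longrightarrow> s i \<in> monoms V (a i)"
  shows "(\<Sum>i\<in>I. s i) \<in> monoms V (\<Sum>i\<in>I. a i)"
  using assms by (induction I rule: infinite_finite_induct) (auto intro: monoms_add)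

text \<open>The rows of the points are constant, and each derivative row consists of linear forms.\<close>

lemma keys_det_interpolation_matrix:
  assumes square: "length vs + card (monomials m e) = card (monomials m (Suc e))"
  shows "keys (det (interpolation_matrix m (Suc e) vs)) \<subseteq> monomials m (card (monomials m e))"
proof
  let ?A = "interpolation_matrix m (Suc e) vs" and ?N = "card (monomials m (Suc e))"
  fix t assume "t \<in> keys (det ?A)"
  moreover have "?A \<in> carrier_mat ?N ?N"
    using interpolation_matrix_carrier[of m "Suc e" vs] square by simp
  ultimately obtain p s where p: "p permutes {..<?N}"
      and s: "\<forall>i<?N. s i \<in> keys (?A $$ (i, p i))" "t = (\<Sum>i<?N. s i)"
    using keys_det by blast
  have "s i \<in> monoms {..m} (if i < length vs then 0 else 1)" if i: "i < ?N" for i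
  proof -
    have pi: "p i < ?N" using permutes_in_image[OF p, of i] i by simp
    have "s i \<in> keys (?A $$ (i, p i))" using s i by auto
    then have si: "s i \<in> keys (if i < length vs
        then single 0 (mono_eval (\<lambda>k. (vs ! i) $ k) (monomial_list m (Suc e) ! p i))
        else diff_op m (monomial_list m e ! (i - length vs)) (single (monomial_list m (Suc e) ! p i) 1))"
      using i pi square by (subst (asm) interpolation_matrix_index) auto
    show ?thesis
    proof (cases "i < length vs")
      case True
      then show ?thesis using si by (auto split: if_splits)
    next
      case False
      have "monomial_list m e ! (i - length vs) \<in> monomials m e"
        using False i square by (intro monomial_list_nth_mem) auto
      then show ?thesis using False si pi
          keys_diff_op[of "single (monomial_list m (Suc e) ! p i) 1" m e]
        by (auto simp: monomial_list_nth_mem simp flip: monomials_eq_monoms)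
    qed
  qed
  then have "t \<in> monoms {..m} (\<Sum>i<?N. if i < length vs then 0 else 1)"
    unfolding s(2) by (intro sum_monoms) auto
  moreover have "(\<Sum>i<?N. if i < length vs then 0 else 1 :: nat) = card (monomials m e)"
  proof -
    have "{i. i < ?N \<and> \<not> i < length vs} = {length vs..<?N}" by auto
    then show ?thesis using square by (simp add: sum.If_cases Int_def)
  qed
  ultimately show "t \<in> monomials m (card (monomials m e))" by (simp add: monomials_eq_monoms)
qed

lemma poly_eval_det: "poly_eval (\<lambda>j. q $ j) (det A) = det (matrix_at A q)"
  unfolding matrix_at_def by (rule comm_ring_hom.hom_det[OF poly_eval_hom, symmetric])

section \<open>Principal ideals are saturated\<close>

lemma poly_ring_sel [simp]:
  "monoid.mult (poly_ring m) = (*)" "one (poly_ring m) = 1"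
  "ring.zero (poly_ring m) = 0" "ring.add (poly_ring m) = (+)"
  by (simp_all add: poly_ring_def)

lemma carrier_poly_ring: "f \<in> carrier (poly_ring m) \<longleftrightarrow> (\<forall>t\<in>keys f. keys t \<subseteq> {..m})"
  by (simp add: poly_ring_def)

lemma cring_poly_ring: "cring (poly_ring m)"
proof (intro cringI abelian_groupI comm_monoidI)
  fix f g assume fg: "f \<in> carrier (poly_ring m)" "g \<in> carrier (poly_ring m)"
  show "f \<oplus>\<^bsub>poly_ring m\<^esub> g \<in> carrier (poly_ring m)"
    using fg keys_add[of f g] by (auto simp: carrier_poly_ring)
  show "f \<otimes>\<^bsub>poly_ring m\<^esub> g \<in> carrier (poly_ring m)"
    using fg keys_mult[of f g] by (fastforce simp: carrier_poly_ring keys_add_nat)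
  show "\<exists>h\<in>carrier (poly_ring m). h \<oplus>\<^bsub>poly_ring m\<^esub> f = \<zero>\<^bsub>poly_ring m\<^esub>"
    using fg(1) by (intro bexI[of _ "- f"]) (auto simp: carrier_poly_ring in_keys_iff)
qed (auto simp: carrier_poly_ring algebra_simps)

lemma genideal_poly_ring:
  assumes "F \<in> carrier (poly_ring m)"
  shows "genideal (poly_ring m) {F} = {g * F | g. g \<in> carrier (poly_ring m)}"
  using cring.cgenideal_eq_genideal[OF cring_poly_ring assms]
  by (simp add: cgenideal_def)

lemma lookup_single_mult: "lookup (single s 1 * g) (s + t) = lookup (g :: 'v cpoly) t"
proof -
  have "single s 1 * g = (\<Sum>u\<in>keys g. single (s + u) (lookup g u))"
    by (subst (1) sum_single_keys[of g, symmetric]) (simp add: sum_distrib_left mult_single)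
  then show ?thesis
    by (auto simp: lookup_sum lookup_single when_def sum.delta in_keys_iff)
qed

text \<open>If \<open>x\<^sub>0\<^sup>k f = g F\<close> and \<open>x\<^sub>1\<^sup>k f = h F\<close>, then \<open>x\<^sub>1\<^sup>k g = x\<^sub>0\<^sup>k h\<close>. Comparing exponents of \<open>x\<^sub>0\<close> shows that
  \<open>x\<^sub>0\<^sup>k\<close> divides every monomial of \<open>g\<close>; cancelling it gives \<open>f\<close> as a multiple of \<open>F\<close>.
  Two coprime variables are needed, hence \<open>m \<ge> 1\<close>.\<close>

lemma saturation_principal:
  assumes m: "m \<ge> 1" and F: "F \<in> carrier (poly_ring m)" "F \<noteq> 0"
  shows "saturation m (genideal (poly_ring m) {F}) = genideal (poly_ring m) {F}"
proof (rule equalityI; rule subsetI)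
  fix f assume "f \<in> saturation m (genideal (poly_ring m) {F})"
  then obtain k where k: "\<And>t. t \<in> monomials m k \<Longrightarrow> single t 1 * f \<in> genideal (poly_ring m) {F}"
    by (auto simp: saturation_def)
  let ?s = "single (0::nat) k" and ?t = "single (1::nat) k"
  have "?s \<in> monomials m k" "?t \<in> monomials m k"
    using m by (auto simp: monomials_def)
  from k[OF this(1)] k[OF this(2)] obtain g h
    where g: "g \<in> carrier (poly_ring m)" "single ?s 1 * f = g * F"
      and h: "single ?t 1 * f = h * F"
    by (auto simp: genideal_poly_ring[OF F(1)])
  have "(single ?t 1 * g) * F = (single ?s 1 * h) * F"
    unfolding mult.assoc g(2)[symmetric] h[symmetric] by (rule mult.left_commute)
  then have gh: "single ?t 1 * g = single ?s 1 * h" using F(2) by simp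
  have div: "?s + (u - ?s) = u" if u: "u \<in> keys g" for u
  proof -
    have "?t + u \<in> keys (single ?s 1 * h)"
      using u lookup_single_mult[of ?t g u] unfolding gh in_keys_iff by simp
    then obtain w where "?t + u = ?s + w"
      using keys_mult[of "single ?s 1" h] by auto
    then have "lookup (?t + u) 0 = lookup (?s + w) 0" by simp
    then have "lookup u 0 \<ge> k" by (simp add: lookup_add lookup_single)
    then show ?thesis
      by (intro poly_mapping_eqI) (auto simp: lookup_add lookup_minus lookup_single when_def)
  qed
  define g' where "g' = (\<Sum>u\<in>keys g. single (u - ?s) (lookup g u))"
  have "single ?s 1 * g' = (\<Sum>u\<in>keys g. single u (lookup g u))"
    unfolding g'_def sum_distrib_left by (intro sum.cong refl) (simp add: mult_single div)
  then have g': "single ?s 1 * g' = g" by (simp add: sum_single_keys)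
  have "single ?s 1 * f = single ?s 1 * (g' * F)"
    using g(2) g' by (simp add: mult.assoc[symmetric])
  moreover have "single ?s (1::complex) \<noteq> 0"
    using lookup_single_eq[of ?s "1::complex"] by (intro notI) simp
  ultimately have "f = g' * F" using mult_left_cancel by blast
  moreover have "g' \<in> carrier (poly_ring m)"
    unfolding carrier_poly_ring
  proof
    fix u assume "u \<in> keys g'"
    then obtain w where w: "w \<in> keys g" "u \<in> keys (single (w - ?s) (lookup g w))"
      using keys_sum[of "\<lambda>u. single (u - ?s) (lookup g u)" "keys g"] unfolding g'_def by auto
    then have "u = w - ?s" by (auto split: if_splits)
    then have "keys u \<subseteq> keys w" by (auto simp: in_keys_iff lookup_minus)
    then show "keys u \<subseteq> {..m}" using g(1) w(1) by (auto simp: carrier_poly_ring)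
  qed
  ultimately show "f \<in> genideal (poly_ring m) {F}"
    by (auto simp: genideal_poly_ring[OF F(1)])
next
  fix f assume f: "f \<in> genideal (poly_ring m) {F}"
  interpret cring "poly_ring m" by (rule cring_poly_ring)
  have "genideal (poly_ring m) {F} \<subseteq> carrier (poly_ring m)"
    using genideal_ideal[of "{F}"] F(1) by (simp add: additive_subgroup.a_subset ideal.axioms(1))
  then show "f \<in> saturation m (genideal (poly_ring m) {F})"
    using f by (auto simp: saturation_def monomials_eq_monoms intro!: exI[of _ 0])
qed

lemma minors_square:
  assumes A: "A \<in> carrier_mat n n"
  shows "minors n A = {det A}"
proof -
  have "{i. i < n \<and> i \<in> {..<n}} = {..<n}" by auto
  then have dims: "dim_row (submatrix A {..<n} {..<n}) = n" "dim_col (submatrix A {..<n} {..<n}) = n"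
    using A by (simp_all add: dim_submatrix)
  have sub: "submatrix A {..<n} {..<n} = A"
  proof (rule eq_matI)
    fix i j assume ij: "i < dim_row A" "j < dim_col A"
    have "{a \<in> {..<n}. a < i} = {..<i}" "{a \<in> {..<n}. a < j} = {..<j}"
      using ij A by auto
    then show "submatrix A {..<n} {..<n} $$ (i, j) = A $$ (i, j)"
      using submatrix_index_card[of i A j "{..<n}" "{..<n}"] ij A by simp
  qed (use A dims in auto)
  have "I = {..<n}" if "I \<subseteq> {..<n}" "card I = n" for I
    using that by (metis card_lessThan card_subset_eq finite_lessThan)
  then have "I \<subseteq> {..<dim_row A} \<and> J \<subseteq> {..<dim_col A} \<and> card I = n \<and> card J = n \<longleftrightarrow>
      I = {..<n} \<and> J = {..<n}" for I J
    using A by auto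
  then show ?thesis by (simp add: minors_def sub)
qed

section \<open>Points of projective space\<close>

definition proj_point :: "complex vec \<Rightarrow> complex vec set" where
  "proj_point v = {c \<cdot>\<^sub>v v | c. c \<noteq> 0}"

lemma mem_proj_point [simp]: "v \<in> proj_point v"
  by (auto simp: proj_point_def intro!: exI[of _ 1])

lemma proportional_image:
  assumes "v \<in> carrier_vec (m + 1)" "v \<noteq> 0\<^sub>v (m + 1)"
  shows "proportional m `` {v} = proj_point v"
  using assms by (auto simp: proportional_def proj_point_def)

lemma proj_point_in_proj_space:
  assumes "v \<in> carrier_vec (m + 1)" "v \<noteq> 0\<^sub>v (m + 1)"
  shows "proj_point v \<in> proj_space m"
  using assms unfolding proj_space_def proportional_image[OF assms, symmetric]
  by (intro quotientI) auto

lemma smult_vec_eq_0_iff: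
  fixes c :: complex
  assumes "v \<in> carrier_vec n"
  shows "c \<cdot>\<^sub>v v = 0\<^sub>v n \<longleftrightarrow> c = 0 \<or> v = 0\<^sub>v n"
  using assms by (auto simp: vec_eq_iff)

lemma proj_point_smult:
  assumes "c \<noteq> 0"
  shows "proj_point (c \<cdot>\<^sub>v v) = proj_point v"
proof -
  have "\<exists>b. b \<noteq> 0 \<and> a \<cdot>\<^sub>v v = b \<cdot>\<^sub>v (c \<cdot>\<^sub>v v)" if "a \<noteq> 0" for a
    using assms that by (intro exI[of _ "a / c"]) (simp add: smult_smult_assoc)
  moreover have "\<exists>b. b \<noteq> 0 \<and> a \<cdot>\<^sub>v (c \<cdot>\<^sub>v v) = b \<cdot>\<^sub>v v" if "a \<noteq> 0" for a
    using assms that by (intro exI[of _ "a * c"]) (simp add: smult_smult_assoc)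
  ultimately show ?thesis unfolding proj_point_def by blast
qed

lemma proj_spaceD:
  assumes "P \<in> proj_space m" "v \<in> P"
  shows "v \<in> carrier_vec (m + 1)" "v \<noteq> 0\<^sub>v (m + 1)" "P = proj_point v"
proof -
  obtain w where w: "w \<in> carrier_vec (m + 1)" "w \<noteq> 0\<^sub>v (m + 1)" "P = proj_point w"
    using assms(1) proportional_image by (auto simp: proj_space_def elim!: quotientE)
  then obtain c where c: "c \<noteq> 0" "v = c \<cdot>\<^sub>v w" using assms(2) by (auto simp: proj_point_def)
  show "v \<in> carrier_vec (m + 1)" "v \<noteq> 0\<^sub>v (m + 1)" "P = proj_point v"
    using w c smult_vec_eq_0_iff[OF w(1)] by (auto simp: proj_point_smult)
qed

lemma obtain_coordinates:
  assumes "P \<in> proj_space m"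
  obtains v where "v \<in> P"
proof -
  obtain w where w: "w \<in> carrier_vec (m + 1)" "w \<noteq> 0\<^sub>v (m + 1)" "P = proportional m `` {w}"
    using assms by (auto simp: proj_space_def elim!: quotientE)
  then show ?thesis using that[of w] by (simp add: proportional_image)
qed

lemma form_eval_smult:
  assumes "keys f \<subseteq> monomials m d" "v \<in> carrier_vec (m + 1)"
  shows "poly_eval (\<lambda>j. (c \<cdot>\<^sub>v v) $ j) f = c ^ d * poly_eval (\<lambda>j. v $ j) f"
proof -
  have "poly_eval (\<lambda>j. (c \<cdot>\<^sub>v v) $ j) f = poly_eval (\<lambda>j. c * v $ j) f"
    using variable_le[OF assms(1)] assms(2) by (intro poly_eval_cong) (simp add: le_imp_less_Suc)
  then show ?thesis using poly_eval_scale[of f "{..m}" d c] assms(1)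
    by (simp add: monomials_eq_monoms)
qed

lemma vanishes_at_proj_point:
  assumes "keys f \<subseteq> monomials m d" "v \<in> carrier_vec (m + 1)"
  shows "vanishes_at f (proj_point v) \<longleftrightarrow> poly_eval (\<lambda>j. v $ j) f = 0"
proof
  assume "vanishes_at f (proj_point v)"
  then show "poly_eval (\<lambda>j. v $ j) f = 0" by (simp add: vanishes_at_def)
next
  assume "poly_eval (\<lambda>j. v $ j) f = 0"
  then show "vanishes_at f (proj_point v)"
    by (auto simp: vanishes_at_def proj_point_def form_eval_smult[OF assms])
qed

section \<open>The generic rank\<close>

lemma keys_aeval_monoms:
  assumes f: "keys f \<subseteq> monoms V d" and \<phi>: "\<And>v. v \<in> V \<Longrightarrow> keys (\<phi> v) \<subseteq> monoms W 1"
  shows "keys (aeval (single 0) \<phi> f) \<subseteq> monoms W d"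
proof
  fix t assume "t \<in> keys (aeval (single 0) \<phi> f)"
  then obtain s where s: "s \<in> keys f"
      and t: "t \<in> keys (single 0 (lookup f s) * (\<Prod>v\<in>keys s. \<phi> v ^ lookup s v))"
    using keys_sum[of "\<lambda>s. single 0 (lookup f s) * (\<Prod>v\<in>keys s. \<phi> v ^ lookup s v)" "keys f"]
    unfolding aeval_def by auto
  have "keys (\<Prod>v\<in>keys s. \<phi> v ^ lookup s v) \<subseteq> monoms W (\<Sum>v\<in>keys s. lookup s v * 1)"
    by (intro keys_prod_monoms keys_power_monoms \<phi>) (use f s in \<open>auto simp: monoms_def\<close>)
  also have "(\<Sum>v\<in>keys s. lookup s v * 1) = d"
    using f s by (auto simp: monoms_def mono_deg_def)
  finally have "keys (single 0 (lookup f s) * (\<Prod>v\<in>keys s. \<phi> v ^ lookup s v)) \<subseteq> monoms W (0 + d)"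
    by (intro keys_mult_monoms) auto
  then show "t \<in> monoms W d" using t by auto
qed

text \<open>For a single point, multihomogeneous means homogeneous.\<close>

lemma multihomogeneous_one_iff:
  "multihomogeneous m 1 f \<longleftrightarrow> (\<exists>e. keys f \<subseteq> monoms ({..<1} \<times> {..m}) e)"
proof -
  have deg: "mono_deg t = (\<Sum>j\<le>m. lookup t (0, j))" if "keys t \<subseteq> {..<1} \<times> {..m}"
    for t :: "(nat \<times> nat) monomial"
  proof -
    have "{..<1::nat} \<times> {..m} = Pair 0 ` {..m}" by auto
    then have "sum (lookup t) ({..<1} \<times> {..m}) = (\<Sum>j\<le>m. lookup t (0, j))"
      by (simp add: sum.reindex inj_on_def)
    then show ?thesis
      using that by (subst mono_deg_superset[of "{..<1} \<times> {..m}"]) auto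
  qed
  show ?thesis
  proof
    assume "multihomogeneous m 1 f"
    then obtain e where e: "\<forall>t\<in>keys f. keys t \<subseteq> {..<1} \<times> {..m} \<and>
        (\<forall>i<1. (\<Sum>j\<le>m. lookup t (i, j)) = e i)"
      unfolding multihomogeneous_def by blast
    then have "keys f \<subseteq> monoms ({..<1} \<times> {..m}) (e 0)"
      using deg by (auto simp: monoms_def)
    then show "\<exists>e. keys f \<subseteq> monoms ({..<1} \<times> {..m}) e" ..
  next
    assume "\<exists>e. keys f \<subseteq> monoms ({..<1} \<times> {..m}) e"
    then obtain e where "keys f \<subseteq> monoms ({..<1} \<times> {..m}) e" ..
    then show "multihomogeneous m 1 f"
      unfolding multihomogeneous_def using deg
      by (intro exI[of _ "\<lambda>_. e"]) (auto simp: monoms_def)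
  qed
qed

text \<open>Irreducibility of projective space in the form that is needed: a nonempty open set meets the
  complement of a hypersurface. On the line from a vector of the open set to a vector where
  \<open>F\<close> does not vanish, each condition excludes only the finitely many roots of a nonzero polynomial
  in one variable.\<close>

lemma general_point_meets_nonvanishing:
  assumes gen: "general_point m \<Phi>" and F: "F \<in> carrier (poly_ring m)" "F \<noteq> 0"
  shows "\<exists>w. w \<in> carrier_vec (m + 1) \<and> w \<noteq> 0\<^sub>v (m + 1) \<and> \<Phi> (proj_point w) \<and>
    poly_eval (\<lambda>j. w $ j) F \<noteq> 0"
proof -
  obtain U where U: "zariski_open m 1 U" "U \<noteq> {}" "\<forall>ps\<in>U. \<Phi> (ps ! 0)"
    using gen by (auto simp: general_point_def general_tuple_def)
  obtain S where S: "\<And>f. f \<in> S \<Longrightarrow> multihomogeneous m 1 f"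
      "U = {ps \<in> point_tuples m 1. \<exists>f\<in>S. \<forall>vs. list_all2 (\<in>) vs ps \<longrightarrow>
            poly_eval (\<lambda>(i, j). (vs ! i) $ j) f \<noteq> 0}"
    using U(1) by (auto simp: zariski_open_def)
  obtain ps f where ps: "ps \<in> point_tuples m 1" and f: "f \<in> S"
      "\<forall>vs. list_all2 (\<in>) vs ps \<longrightarrow> poly_eval (\<lambda>(i, j). (vs ! i) $ j) f \<noteq> 0"
    using U(2) S(2) by auto
  obtain P where P: "ps = [P]" "P \<in> proj_space m"
    using ps by (auto simp: point_tuples_def length_Suc_conv)
  obtain v where v: "v \<in> P" using obtain_coordinates[OF P(2)] .
  note vP = proj_spaceD[OF P(2) v]
  obtain e where e: "keys f \<subseteq> monoms ({..<1} \<times> {..m}) e"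
    using S(1)[OF f(1)] unfolding multihomogeneous_one_iff ..
  have kf: "i = 0 \<and> j \<le> m" if "t \<in> keys f" "(i, j) \<in> keys t" for t i j
    using e that by (auto simp: monoms_def)
  have kF: "j \<le> m" if "t \<in> keys F" "j \<in> keys t" for t j
    using F(1) that by (auto simp: carrier_poly_ring)
  have "poly_eval (\<lambda>(i, j). ([v] ! i) $ j) f \<noteq> 0" using f(2) v P by auto
  also have "poly_eval (\<lambda>(i, j). ([v] ! i) $ j) f = poly_eval (\<lambda>(i, j). v $ j) f"
    by (intro poly_eval_cong) (auto split: prod.splits dest: kf)
  finally have fv: "poly_eval (\<lambda>(i, j). v $ j) f \<noteq> 0" .
  obtain a where a: "poly_eval a F \<noteq> 0" using poly_zero_if_eval_zero F(2) by blast
  obtain k where k: "k \<le> m" "v $ k \<noteq> 0"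
    using vP by (auto simp: vec_eq_iff le_simps)
  let ?p = "line_poly (\<lambda>(i, j). v $ j) (\<lambda>(i, j). a j - v $ j) f"
  let ?q = "line_poly (\<lambda>j. v $ j) (\<lambda>j. a j - v $ j) F"
  let ?r = "[:v $ k, a k - v $ k:]"
  have "poly ?p 0 \<noteq> 0" using fv by (simp add: poly_line_poly case_prod_unfold)
  then have "?p \<noteq> 0" by auto
  moreover have "poly ?q 1 \<noteq> 0" using a by (simp add: poly_line_poly)
  then have "?q \<noteq> 0" by auto
  \<comment> \<open>This factor keeps the vector on the line from being zero, so that it represents a point.\<close>
  moreover have "?r \<noteq> 0" using k(2) by simp
  ultimately have "?p * ?q * ?r \<noteq> 0" by (simp only: mult_eq_0_iff simp_thms)
  then obtain x where "poly (?p * ?q * ?r) x \<noteq> 0" using poly_all_0_iff_0 by blast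
  then have x: "poly ?p x \<noteq> 0" "poly ?q x \<noteq> 0" "poly ?r x \<noteq> 0"
    unfolding poly_mult mult_eq_0_iff de_Morgan_disj by blast+
  define w where "w = vec (m + 1) (\<lambda>j. v $ j + x * (a j - v $ j))"
  have wj: "w $ j = v $ j + x * (a j - v $ j)" if "j \<le> m" for j
    using that by (simp add: w_def)
  have w: "w \<in> carrier_vec (m + 1)" by (simp add: w_def)
  have "w $ k \<noteq> 0" using x(3) k(1) by (simp add: wj)
  then have w0: "w \<noteq> 0\<^sub>v (m + 1)" using k(1) by auto
  have "poly_eval (\<lambda>j. w $ j) F = poly ?q x"
    unfolding poly_line_poly by (rule poly_eval_cong) (use kF wj in auto)
  then have Fw: "poly_eval (\<lambda>j. w $ j) F \<noteq> 0" using x by simp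
  have "poly_eval (\<lambda>(i, j). w $ j) f = poly ?p x"
    unfolding poly_line_poly by (rule poly_eval_cong) (use kf wj in \<open>auto split: prod.splits\<close>)
  then have fw: "poly_eval (\<lambda>(i, j). w $ j) f \<noteq> 0" using x by simp
  have "poly_eval (\<lambda>(i, j). (vs ! i) $ j) f \<noteq> 0" if vs: "list_all2 (\<in>) vs [proj_point w]" for vs
  proof -
    obtain c where c: "c \<noteq> 0" "vs = [c \<cdot>\<^sub>v w]"
      using vs by (auto simp: list_all2_Cons2 proj_point_def)
    have "poly_eval (\<lambda>(i, j). (vs ! i) $ j) f = poly_eval (\<lambda>v. c * (\<lambda>(i, j). w $ j) v) f"
    proof (rule poly_eval_cong)
      fix t v assume tv: "t \<in> keys f" "v \<in> keys t"
      obtain i j where v: "v = (i, j)" by (cases v)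
      then show "(\<lambda>(i, j). (vs ! i) $ j) v = c * (\<lambda>(i, j). w $ j) v"
        using kf[of t i j] tv c w by (simp add: le_imp_less_Suc)
    qed
    also have "\<dots> = c ^ e * poly_eval (\<lambda>(i, j). w $ j) f"
      by (rule poly_eval_scale[OF e])
    finally show ?thesis using c fw by simp
  qed
  then have "[proj_point w] \<in> U"
    using f(1) proj_point_in_proj_space[OF w w0] by (auto simp: S(2) point_tuples_def)
  then have "\<Phi> ([proj_point w] ! 0)" using U(3) by blast
  then show ?thesis using w w0 Fw by auto
qed

lemma general_point_nonvanishing:
  assumes F: "keys F \<subseteq> monomials m e"
    and q: "q \<in> carrier_vec (m + 1)" "q \<noteq> 0\<^sub>v (m + 1)" "poly_eval (\<lambda>j. q $ j) F \<noteq> 0"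
  shows "general_point m (\<lambda>Q. \<forall>v\<in>Q. poly_eval (\<lambda>j. v $ j) F \<noteq> 0)"
proof -
  define F' :: "(nat \<times> nat) cpoly" where
    "F' = aeval (single 0) (\<lambda>j. single (single (0, j) 1) 1) F"
  have evF': "poly_eval (\<lambda>(i, j). (vs ! i) $ j) F' = poly_eval (\<lambda>j. (vs ! 0) $ j) F" for vs
    by (simp add: F'_def poly_eval_aeval)
  have "keys F' \<subseteq> monoms ({..<1} \<times> {..m}) e"
    unfolding F'_def using F by (intro keys_aeval_monoms[of _ "{..m}"])
      (auto simp: monomials_eq_monoms monoms_def)
  then have mh: "multihomogeneous m 1 F'" by (auto simp only: multihomogeneous_one_iff)
  define U where "U = {ps \<in> point_tuples m 1. \<exists>f\<in>{F'}. \<forall>vs. list_all2 (\<in>) vs ps \<longrightarrow>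
            poly_eval (\<lambda>(i, j). (vs ! i) $ j) f \<noteq> 0}"
  have "zariski_open m 1 U"
    unfolding zariski_open_def using mh by (intro exI[of _ "{F'}"]) (auto simp: U_def)
  moreover have "[proj_point q] \<in> U"
  proof -
    have "poly_eval (\<lambda>j. v $ j) F \<noteq> 0" if "v \<in> proj_point q" for v
      using that q(3) by (auto simp: proj_point_def form_eval_smult[OF F q(1)])
    then show ?thesis
      using proj_point_in_proj_space[OF q(1,2)]
      by (auto simp: U_def evF' point_tuples_def list_all2_Cons2)
  qed
  moreover have "\<forall>ps\<in>U. \<forall>v\<in>ps ! 0. poly_eval (\<lambda>j. v $ j) F \<noteq> 0"
  proof (intro ballI)
    fix ps v assume "ps \<in> U" "v \<in> ps ! 0"
    moreover from this obtain P where "ps = [P]"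
      by (auto simp: U_def point_tuples_def length_Suc_conv)
    ultimately have "poly_eval (\<lambda>(i, j). ([v] ! i) $ j) F' \<noteq> 0"
      by (simp add: U_def del: One_nat_def)
    then show "poly_eval (\<lambda>j. v $ j) F \<noteq> 0" by (simp add: evF')
  qed
  ultimately show ?thesis unfolding general_point_def general_tuple_def by blast
qed

text \<open>Full rank holds on the open set where the determinant does not vanish. By irreducibility, every
  other nonempty open set contains points of full rank, so no other value can be the generic one.\<close>

lemma general_rank_square:
  assumes A: "A \<in> carrier_mat n n" and F: "keys (det A) \<subseteq> monomials m e"
    and q: "q \<in> carrier_vec (m + 1)" "q \<noteq> 0\<^sub>v (m + 1)" "det (matrix_at A q) \<noteq> 0"
  shows "general_rank m A = n"
  unfolding general_rank_def
proof (rule the_equality)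
  have Aq: "matrix_at A v \<in> carrier_mat n n" for v using A by (simp add: matrix_at_def)
  have rank: "vec_space.rank (dim_row A) (matrix_at A v) = n \<longleftrightarrow> poly_eval (\<lambda>j. v $ j) (det A) \<noteq> 0" for v
    using vec_space.det_rank_iff[OF Aq[of v]] A by (simp add: poly_eval_det)
  have ev: "poly_eval (\<lambda>j. q $ j) (det A) \<noteq> 0" using q(3) by (simp add: poly_eval_det)
  show "general_point m (\<lambda>Q. \<forall>v\<in>Q. vec_space.rank (dim_row A) (matrix_at A v) = n)"
    unfolding rank by (rule general_point_nonvanishing[OF F q(1,2) ev])
next
  fix \<rho> assume gen: "general_point m (\<lambda>Q. \<forall>v\<in>Q. vec_space.rank (dim_row A) (matrix_at A v) = \<rho>)"
  have "det A \<in> carrier (poly_ring m)" using F by (auto simp: carrier_poly_ring monomials_def)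
  moreover have "det A \<noteq> 0" using q(3) by (auto simp flip: poly_eval_det)
  ultimately obtain w where w: "\<forall>v\<in>proj_point w. vec_space.rank (dim_row A) (matrix_at A v) = \<rho>"
      "poly_eval (\<lambda>j. w $ j) (det A) \<noteq> 0"
    using general_point_meets_nonvanishing[OF gen] by blast
  have Aw: "matrix_at A w \<in> carrier_mat n n" using A by (simp add: matrix_at_def)
  have "vec_space.rank (dim_row A) (matrix_at A w) = n"
    using vec_space.det_rank_iff[OF Aw] A w(2) by (simp add: poly_eval_det)
  then show "\<rho> = n" using w(1) mem_proj_point by auto
qed

section \<open>Projection from a point and cones\<close>

text \<open>The linear projection from \<open>p\<close> onto the hyperplane with normal vector \<open>h\<close>.\<close>

definition proj_vec :: "complex vec \<Rightarrow> complex vec \<Rightarrow> complex vec \<Rightarrow> complex vec" where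
  "proj_vec h p x = x - (scalar_prod h x / scalar_prod h p) \<cdot>\<^sub>v p"

lemma scalar_prod_proj_vec:
  assumes "h \<in> carrier_vec k" "p \<in> carrier_vec k" "x \<in> carrier_vec k" "scalar_prod h p \<noteq> 0"
  shows "scalar_prod h (proj_vec h p x) = 0"
  using assms by (simp add: proj_vec_def scalar_prod_minus_distrib)

lemma projection_eq:
  assumes h: "h \<in> carrier_vec (m + 1)" and H: "H = {P \<in> proj_space m. \<forall>v\<in>P. scalar_prod h v = 0}"
    and P: "P \<in> proj_space m" "p \<in> P" "scalar_prod h p \<noteq> 0"
    and X: "X \<in> proj_space m" "x \<in> X" "X \<noteq> P"
  shows "proj_vec h p x \<noteq> 0\<^sub>v (m + 1)" "projection m H P X = proj_point (proj_vec h p x)"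
proof -
  note p = proj_spaceD[OF P(1,2)] and x = proj_spaceD[OF X(1,2)]
  let ?y = "proj_vec h p x"
  let ?t = "scalar_prod h x / scalar_prod h p"
  have y: "?y \<in> carrier_vec (m + 1)" using p x by (simp add: proj_vec_def)
  have hy: "scalar_prod h ?y = 0" by (rule scalar_prod_proj_vec[OF h p(1) x(1) P(3)])
  have x_eq: "x = ?y + ?t \<cdot>\<^sub>v p" using p x by (auto simp: proj_vec_def)
  show y0: "?y \<noteq> 0\<^sub>v (m + 1)"
  proof
    assume "?y = 0\<^sub>v (m + 1)"
    then have xt: "x = ?t \<cdot>\<^sub>v p" using x_eq p by auto
    then have "?t \<noteq> 0" using x(2) p(1) by auto
    then have "X = P" using xt x(3) p(3) proj_point_smult by metis
    then show False using X(3) by simp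
  qed
  show "projection m H P X = proj_point ?y"
    unfolding projection_def
  proof (rule the_equality)
    have "proj_point ?y \<in> H"
      using proj_point_in_proj_space[OF y y0] h y hy by (auto simp: H proj_point_def)
    moreover have "?y = (- ?t) \<cdot>\<^sub>v p + 1 \<cdot>\<^sub>v x" using p x by (auto simp: proj_vec_def)
    then have "proj_point ?y \<in> proj_line m P X"
      using proj_point_in_proj_space[OF y y0] P(2) X(2) mem_proj_point
      unfolding proj_line_def by blast
    ultimately show "proj_point ?y \<in> H \<and> proj_point ?y \<in> proj_line m P X" ..
  next
    fix Y assume Y: "Y \<in> H \<and> Y \<in> proj_line m P X"
    then obtain p' x' y' a b where y': "Y \<in> proj_space m" "p' \<in> P" "x' \<in> X" "y' \<in> Y"
        "y' = a \<cdot>\<^sub>v p' + b \<cdot>\<^sub>v x'"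
      by (auto simp: proj_line_def)
    obtain c c' where c: "p' = c \<cdot>\<^sub>v p" "x' = c' \<cdot>\<^sub>v x"
      using y'(2,3) p(3) x(3) by (auto simp: proj_point_def)
    have y'_eq: "y' = (a * c) \<cdot>\<^sub>v p + (b * c') \<cdot>\<^sub>v x"
      using y'(5) c by (simp add: smult_smult_assoc)
    have "scalar_prod h y' = 0" using Y y'(4) by (auto simp: H)
    then have "a * c * scalar_prod h p + b * c' * scalar_prod h x = 0"
      using h p x by (simp add: y'_eq scalar_prod_add_distrib[of h "m + 1"])
    then have "a * c = - (b * c') * ?t" using P(3) by (simp add: field_simps add_eq_0_iff)
    then have y'y: "y' = (b * c') \<cdot>\<^sub>v ?y"
      using p x by (auto simp: y'_eq proj_vec_def algebra_simps)
    have "b * c' \<noteq> 0" using proj_spaceD(2)[OF y'(1,4)] y y'y by auto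
    then show "Y = proj_point ?y"
      using proj_spaceD(3)[OF y'(1,4)] y'y by (simp add: proj_point_smult)
  qed
qed

lemma form_nonzero_at_vec:
  assumes "keys f \<subseteq> monomials m d" "f \<noteq> 0"
  obtains x where "x \<in> carrier_vec (m + 1)" "poly_eval (\<lambda>j. x $ j) f \<noteq> 0"
proof -
  obtain a where a: "poly_eval a f \<noteq> 0" using poly_zero_if_eval_zero assms(2) by blast
  have "poly_eval (\<lambda>j. vec (m + 1) a $ j) f = poly_eval a f"
    using variable_le[OF assms(1)] by (intro poly_eval_cong) (simp add: le_imp_less_Suc)
  then show ?thesis using a that[of "vec (m + 1) a"] by simp
qed

text \<open>A projected vector differs from the original one by a multiple of the vertex.\<close>

lemma cone_eval_proj_vec:
  assumes f: "keys f \<subseteq> monomials m d" and "dir_deriv m (\<lambda>j. p $ j) f = 0"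
    and "p \<in> carrier_vec (m + 1)" "x \<in> carrier_vec (m + 1)"
  shows "poly_eval (\<lambda>j. proj_vec h p x $ j) f = poly_eval (\<lambda>j. x $ j) f"
proof -
  let ?t = "scalar_prod h x / scalar_prod h p"
  have "keys t \<subseteq> {..m}" if "t \<in> keys f" for t using f that by (auto simp: monomials_def)
  then have const: "\<forall>a c. poly_eval (\<lambda>j. a j + c * p $ j) f = poly_eval a f"
    using dir_deriv_eq_0_iff assms(2) by blast
  have "poly_eval (\<lambda>j. proj_vec h p x $ j) f = poly_eval (\<lambda>j. x $ j + (- ?t) * p $ j) f"
    using variable_le[OF f] assms(3,4)
    by (intro poly_eval_cong) (simp add: proj_vec_def le_imp_less_Suc)
  also have "\<dots> = poly_eval (\<lambda>j. x $ j) f"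
    by (rule const[rule_format])
  finally show ?thesis .
qed

text \<open>A cone with vertex \<open>p\<close> takes equal values at a vector and at its projection. So a cone through
  the points vanishes at their projections, and it does not vanish on \<open>H\<close>, since otherwise it would
  vanish everywhere. Conversely, the pullback along the projection of a form that does not vanish on
  \<open>H\<close> is a cone of the same degree.\<close>

lemma on_hypersurface_iff_has_cone:
  assumes h: "h \<in> carrier_vec (m + 1)" and H: "H = {P \<in> proj_space m. \<forall>v\<in>P. scalar_prod h v = 0}"
    and d: "d \<ge> 1"
    and P: "P \<in> proj_space m" "p \<in> P" "P \<notin> H"
    and Z: "Z \<subseteq> proj_space m" "P \<notin> Z"
    and S: "\<And>X. X \<in> Z \<Longrightarrow> \<exists>x\<in>S. x \<in> X" "\<And>x. x \<in> S \<Longrightarrow> \<exists>X\<in>Z. x \<in> X"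
  shows "on_hypersurface m H d (projection m H P ` Z) \<longleftrightarrow> has_cone m d p S"
proof -
  note p = proj_spaceD[OF P(1,2)]
  let ?L = "proj_vec h p"
  have hp: "scalar_prod h p \<noteq> 0"
    using P(1,3) p h by (auto simp: H proj_point_def)
  have L: "?L x \<in> carrier_vec (m + 1)" if "x \<in> carrier_vec (m + 1)" for x
    using that p by (simp add: proj_vec_def)
  have proj: "projection m H P X = proj_point (?L x)" if "X \<in> Z" "x \<in> X" for X x
    using projection_eq(2)[OF h H P(1,2) hp, of X x] Z that by auto
  have cS: "x \<in> carrier_vec (m + 1)" if "x \<in> S" for x
    using S(2)[OF that] Z(1) proj_spaceD(1) by blast
  have vanish: "(\<forall>Y\<in>projection m H P ` Z. vanishes_at g Y) \<longleftrightarrow>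
      (\<forall>x\<in>S. poly_eval (\<lambda>j. ?L x $ j) g = 0)" if g: "keys g \<subseteq> monomials m d" for g
  proof
    assume *: "\<forall>Y\<in>projection m H P ` Z. vanishes_at g Y"
    show "\<forall>x\<in>S. poly_eval (\<lambda>j. ?L x $ j) g = 0"
    proof
      fix x assume x: "x \<in> S"
      then obtain X where "X \<in> Z" "x \<in> X" using S(2) by blast
      then show "poly_eval (\<lambda>j. ?L x $ j) g = 0"
        using * proj vanishes_at_proj_point[OF g L[OF cS[OF x]]] by auto
    qed
  next
    assume *: "\<forall>x\<in>S. poly_eval (\<lambda>j. ?L x $ j) g = 0"
    show "\<forall>Y\<in>projection m H P ` Z. vanishes_at g Y"
    proof (intro ballI, elim imageE)
      fix Y X assume X: "X \<in> Z" "Y = projection m H P X"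
      then obtain x where "x \<in> S" "x \<in> X" using S(1) by blast
      then show "vanishes_at g Y"
        using X * proj vanishes_at_proj_point[OF g L[OF cS]] by auto
    qed
  qed
  show ?thesis
  proof
    assume "has_cone m d p S"
    then obtain f where f: "is_form m d f" "\<forall>x\<in>S. poly_eval (\<lambda>j. x $ j) f = 0"
        "dir_deriv m (\<lambda>j. p $ j) f = 0"
      by (auto simp: has_cone_def)
    then have kf: "f \<noteq> 0" "keys f \<subseteq> monomials m d" by (auto simp: is_form_def)
    have inv: "poly_eval (\<lambda>j. ?L x $ j) f = poly_eval (\<lambda>j. x $ j) f" if "x \<in> carrier_vec (m + 1)" for x
      by (rule cone_eval_proj_vec[OF kf(2) f(3) p(1) that])
    obtain x where x: "x \<in> carrier_vec (m + 1)" "poly_eval (\<lambda>j. x $ j) f \<noteq> 0"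
      using form_nonzero_at_vec[OF kf(2,1)] .
    have Lx: "poly_eval (\<lambda>j. ?L x $ j) f \<noteq> 0" using inv[OF x(1)] x(2) by simp
    have Lx0: "?L x \<noteq> 0\<^sub>v (m + 1)"
    proof
      assume "?L x = 0\<^sub>v (m + 1)"
      then have "?L x = 0 \<cdot>\<^sub>v x" using x(1) by auto
      then show False using Lx form_eval_smult[OF kf(2) x(1), of 0] d by simp
    qed
    have "proj_point (?L x) \<in> H"
      using proj_point_in_proj_space[OF L[OF x(1)] Lx0] scalar_prod_proj_vec[OF h p(1) x(1) hp]
        h L[OF x(1)] by (auto simp: H proj_point_def)
    moreover have "\<not> vanishes_at f (proj_point (?L x))"
      using vanishes_at_proj_point[OF kf(2) L[OF x(1)]] Lx by simp
    moreover have "\<forall>Y\<in>projection m H P ` Z. vanishes_at f Y"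
      using vanish[OF kf(2)] inv cS f(2) by simp
    ultimately show "on_hypersurface m H d (projection m H P ` Z)"
      using f(1) by (auto simp: on_hypersurface_def)
  next
    assume "on_hypersurface m H d (projection m H P ` Z)"
    then obtain g Y where g: "is_form m d g" "\<forall>Y\<in>projection m H P ` Z. vanishes_at g Y"
        and Y: "Y \<in> H" "\<not> vanishes_at g Y"
      by (auto simp: on_hypersurface_def)
    have kg: "keys g \<subseteq> monomials m d" using g(1) by (simp add: is_form_def)
    \<comment> \<open>The coordinates of the projected vector, as linear forms in the coordinates of the vector.\<close>
    define \<phi> :: "nat \<Rightarrow> nat cpoly" where "\<phi> j = single (single j 1) 1 +
      (\<Sum>k\<le>m. single (single k 1) (- (h $ k / scalar_prod h p * p $ j)))" for j
    define f where "f = aeval (single 0) \<phi> g"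
    have ev_f: "poly_eval a f = poly_eval (\<lambda>j. a j - (\<Sum>k\<le>m. h $ k * a k) / scalar_prod h p * p $ j) g" for a
      unfolding f_def poly_eval_aeval \<phi>_def
      by (simp add: poly_eval_add poly_eval_sum sum_divide_distrib sum_distrib_right
          sum_distrib_left sum_negf mult_ac)
    have sp: "scalar_prod h x = (\<Sum>k\<le>m. h $ k * x $ k)" if "x \<in> carrier_vec (m + 1)" for x
      using that by (simp add: scalar_prod_def atLeast0LessThan lessThan_Suc_atMost)
    have ev_f_vec: "poly_eval (\<lambda>j. x $ j) f = poly_eval (\<lambda>j. ?L x $ j) g"
      if x: "x \<in> carrier_vec (m + 1)" for x
      unfolding ev_f sp[OF x, symmetric] using variable_le[OF kg] x p(1)
      by (intro poly_eval_cong) (simp add: proj_vec_def le_imp_less_Suc)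
    have "keys f \<subseteq> monomials m d"
    proof -
      have k\<phi>: "keys (\<phi> j) \<subseteq> monoms {..m} 1" if j: "j \<le> m" for j
      proof -
        have "keys (\<phi> j) \<subseteq> keys (single (single j 1) (1::complex)) \<union>
            (\<Union>k\<le>m. keys (single (single k 1) (- (h $ k / scalar_prod h p * p $ j))))"
          unfolding \<phi>_def
          by (rule subset_trans[OF keys_add Un_mono[OF subset_refl keys_sum]])
        also have "\<dots> \<subseteq> monoms {..m} 1"
          unfolding monoms_1 using j by auto
        finally show ?thesis .
      qed
      then show ?thesis
        using keys_aeval_monoms[of g "{..m}" d \<phi>] kg by (simp add: f_def monomials_eq_monoms)
    qed
    moreover have "f \<noteq> 0"
    proof -
      have YP: "Y \<in> proj_space m" using Y(1) by (simp add: H)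
      obtain y where y: "y \<in> Y" "poly_eval (\<lambda>j. y $ j) g \<noteq> 0"
        using Y(2) by (auto simp: vanishes_at_def)
      note yc = proj_spaceD(1)[OF YP y(1)]
      have "scalar_prod h y = 0" using Y(1) y(1) by (simp add: H)
      then have "?L y = y" using yc p(1) by (auto simp: proj_vec_def)
      then have "poly_eval (\<lambda>j. y $ j) f \<noteq> 0" using ev_f_vec[OF yc] y(2) by simp
      then show ?thesis by auto
    qed
    moreover have "\<forall>x\<in>S. poly_eval (\<lambda>j. x $ j) f = 0"
      using ev_f_vec cS vanish[OF kg] g(2) by simp
    moreover have "dir_deriv m (\<lambda>j. p $ j) f = 0"
    proof -
      have "poly_eval (\<lambda>j. a j + x * p $ j) f = poly_eval a f" for a x
      proof -
        have "(\<Sum>k\<le>m. h $ k * (a k + x * p $ k)) = (\<Sum>k\<le>m. h $ k * a k) + x * scalar_prod h p"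
          by (simp add: sp[OF p(1)] sum.distrib sum_distrib_left algebra_simps)
        then show ?thesis unfolding ev_f using hp
          by (intro poly_eval_cong) (simp add: field_simps)
      qed
      then show ?thesis
        using \<open>keys f \<subseteq> monomials m d\<close> by (subst dir_deriv_eq_0_iff) (auto simp: monomials_def)
    qed
    ultimately show "has_cone m d p S" by (auto simp: has_cone_def is_form_def)
  qed
qed

section \<open>The open set of point configurations\<close>

text \<open>The monomial \<open>t\<close> in the coordinates of the point with index \<open>i\<close>.\<close>

definition put_mono :: "nat \<Rightarrow> nat monomial \<Rightarrow> (nat \<times> nat) monomial" where
  "put_mono i t = (\<Sum>j\<in>keys t. single (i, j) (lookup t j))"

lemma lookup_put_mono: "lookup (put_mono i t) (k, j) = (if k = i then lookup t j else 0)"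
  by (auto simp: put_mono_def lookup_sum lookup_single when_def sum.delta in_keys_iff)

lemma mono_eval_put_mono: "mono_eval a (put_mono i t) = mono_eval (\<lambda>j. a (i, j)) t"
proof -
  have "mono_eval a (\<Sum>j\<in>J. single (i, j) (lookup t j)) = (\<Prod>j\<in>J. a (i, j) ^ lookup t j)" for J
    by (induction J rule: infinite_finite_induct) (auto simp: mono_eval_add)
  then show ?thesis by (simp add: put_mono_def mono_eval_def[of _ t])
qed

text \<open>The interpolation matrix with its vertex specialized to \<open>q\<close> and with indeterminate points. Its
  determinant describes which tuples of points admit no cone with vertex \<open>q\<close>.\<close>

definition points_matrix :: "nat \<Rightarrow> nat \<Rightarrow> nat \<Rightarrow> complex vec \<Rightarrow> (nat \<times> nat) cpoly mat" where
  "points_matrix m d r q =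
    mat (r + card (monomials m (d - 1))) (card (monomials m d)) (\<lambda>(i, j).
      if i < r then single (put_mono i (monomial_list m d ! j)) 1
      else single 0 (poly_eval (\<lambda>j. q $ j)
        (diff_op m (monomial_list m (d - 1) ! (i - r)) (single (monomial_list m d ! j) 1))))"

lemma poly_eval_det_points_matrix:
  assumes "length vs = r"
  shows "poly_eval (\<lambda>(i, j). (vs ! i) $ j) (det (points_matrix m d r q)) =
    det (matrix_at (interpolation_matrix m d vs) q)"
proof -
  have "map_mat (poly_eval (\<lambda>(i, j). (vs ! i) $ j)) (points_matrix m d r q) =
      matrix_at (interpolation_matrix m d vs) q"
    using assms interpolation_matrix_carrier[of m d vs]
    by (intro eq_matI) (auto simp: points_matrix_def matrix_at_def interpolation_matrix_index
        mono_eval_put_mono)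
  then show ?thesis by (metis comm_ring_hom.hom_det[OF poly_eval_hom])
qed

text \<open>Each term of the determinant contains, for every point, exactly one entry of the row of this point,
  a monomial of degree \<open>d\<close> in its coordinates; the other rows are constant.\<close>

lemma multihomogeneous_det_points_matrix:
  assumes square: "r + card (monomials m (d - 1)) = card (monomials m d)"
  shows "multihomogeneous m r (det (points_matrix m d r q))"
  unfolding multihomogeneous_def
proof (intro exI[of _ "\<lambda>_. d"] ballI conjI allI impI)
  let ?N = "card (monomials m d)" and ?A = "points_matrix m d r q"
  fix t assume t: "t \<in> keys (det ?A)"
  have "?A \<in> carrier_mat ?N ?N" using square by (simp add: points_matrix_def)
  then obtain p s where p: "p permutes {..<?N}"
      and s: "\<forall>i<?N. s i \<in> keys (?A $$ (i, p i))" "t = (\<Sum>i<?N. s i)"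
    using keys_det t by blast
  have entry: "\<exists>u\<in>monomials m d. s i = (if i < r then put_mono i u else 0)" if i: "i < ?N" for i
  proof -
    have pi: "p i < ?N" using permutes_in_image[OF p, of i] i by simp
    have "s i \<in> keys (?A $$ (i, p i))" using s i by auto
    then have "s i = (if i < r then put_mono i (monomial_list m d ! p i) else 0)"
      using i pi square by (auto simp: points_matrix_def split: if_splits)
    then show ?thesis using monomial_list_nth_mem[OF pi] by blast
  qed
  show "keys t \<subseteq> {..<r} \<times> {..m}"
  proof clarify
    fix k j assume "(k, j) \<in> keys t"
    then have "(\<Sum>i<?N. lookup (s i) (k, j)) \<noteq> 0" by (simp add: in_keys_iff s(2) lookup_sum)
    then obtain i where i: "i < ?N" "lookup (s i) (k, j) \<noteq> 0"
      by (metis lessThan_iff sum.neutral)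
    obtain u where u: "u \<in> monomials m d" "s i = (if i < r then put_mono i u else 0)"
      using entry[OF i(1)] by blast
    then have "k < r" "lookup u j \<noteq> 0"
      using i(2) by (auto simp: lookup_put_mono split: if_splits)
    then show "k \<in> {..<r} \<and> j \<in> {..m}"
      using u(1) by (auto simp: monomials_def subset_iff simp flip: lookup_not_eq_zero_eq_in_keys)
  qed
  fix k assume k: "k < r"
  have "(\<Sum>j\<le>m. lookup (s i) (k, j)) = (if i = k then d else 0)" if i: "i < ?N" for i
  proof -
    obtain u where u: "u \<in> monomials m d" "s i = (if i < r then put_mono i u else 0)"
      using entry[OF i] by blast
    have "(\<Sum>j\<le>m. lookup u j) = d"
      using u(1) by (subst mono_deg_superset[of "{..m}", symmetric]) (auto simp: monomials_def)
    then show ?thesis using u(2) k by (auto simp: lookup_put_mono)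
  qed
  then have "(\<Sum>i<?N. \<Sum>j\<le>m. lookup (s i) (k, j)) = (\<Sum>i<?N. if i = k then d else 0)"
    by (intro sum.cong) auto
  also have "\<dots> = d" using k square by simp
  finally show "(\<Sum>j\<le>m. lookup t (k, j)) = d"
    by (simp add: s(2) lookup_sum sum.swap[of _ "{..m}"])
qed

lemma same_points_scale:
  assumes "list_all2 (\<in>) vs ps" "list_all2 (\<in>) us qs" "set ps \<subseteq> set qs" "set qs \<subseteq> proj_space m"
    and "v \<in> set vs"
  shows "\<exists>c w. w \<in> set us \<and> v = c \<cdot>\<^sub>v w" "v \<in> carrier_vec (m + 1)"
proof -
  obtain P where P: "P \<in> set ps" "v \<in> P"
    using assms(1,5) by (metis in_set_conv_nth list_all2_conv_all_nth)
  then have "P \<in> set qs" using assms(3) by auto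
  then obtain w where w: "w \<in> set us" "w \<in> P"
    using assms(2) by (metis in_set_conv_nth list_all2_conv_all_nth)
  have PP: "P \<in> proj_space m" using \<open>P \<in> set qs\<close> assms(4) by auto
  show "\<exists>c w. w \<in> set us \<and> v = c \<cdot>\<^sub>v w"
    using P w proj_spaceD(3)[OF PP w(2)] by (auto simp: proj_point_def)
  show "v \<in> carrier_vec (m + 1)" by (rule proj_spaceD(1)[OF PP P(2)])
qed

text \<open>Neither the order of the points nor the choice of their coordinates matters for the existence of a
  cone. This is how a condition on tuples of points becomes one on the set of points.\<close>

lemma has_cone_same_points:
  assumes "list_all2 (\<in>) vs ps" "list_all2 (\<in>) us qs" "set ps = set qs" "set qs \<subseteq> proj_space m"
    and "has_cone m d q (set us)"
  shows "has_cone m d q (set vs)"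
  using same_points_scale[OF assms(1,2) _ assms(4)] assms(3)
  by (intro has_cone_rescale[OF _ _ assms(5)]) auto

lemma coordinate_list_exists:
  assumes "set ps \<subseteq> proj_space m"
  obtains vs where "list_all2 (\<in>) vs ps"
proof -
  have "\<forall>P\<in>set ps. \<exists>v. v \<in> P" using assms obtain_coordinates by blast
  then obtain f where "\<forall>P\<in>set ps. f P \<in> P" by metis
  then have "list_all2 (\<in>) (map f ps) ps" by (simp add: list_all2_conv_all_nth)
  then show ?thesis using that by blast
qed

text \<open>The last equation makes the interpolation matrix square: a monomial of degree \<open>e + 1\<close> either does
  not contain \<open>x\<^sub>0\<close> or is \<open>x\<^sub>0\<close> times a monomial of degree \<open>e\<close>.\<close>

lemma card_monomials_square:
  shows "card (monomials m e) = (m + e) choose e"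
    and "card (monoms {1..m} (Suc e)) = (m + e) choose Suc e"
    and "card (monomials m (Suc e)) = card (monoms {1..m} (Suc e)) + card (monomials m e)"
  by (simp_all add: monomials_eq_monoms card_monoms add.commute)

text \<open>A repeated point would give two equal rows, hence a vanishing determinant and a cone.\<close>

lemma distinct_if_no_cone:
  assumes square: "length ps + card (monomials m e) = card (monomials m (Suc e))"
    and ps: "set ps \<subseteq> proj_space m"
    and no_cone: "\<And>vs. list_all2 (\<in>) vs ps \<Longrightarrow> \<not> has_cone m (Suc e) q (set vs)"
  shows "distinct ps"
proof (rule ccontr)
  assume "\<not> distinct ps"
  then obtain i j where ij: "i < length ps" "j < length ps" "i \<noteq> j" "ps ! i = ps ! j"
    by (auto simp: distinct_conv_nth)
  have "\<forall>P\<in>set ps. \<exists>v. v \<in> P" using ps obtain_coordinates by blast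
  then obtain f where f: "\<forall>P\<in>set ps. f P \<in> P" by metis
  let ?vs = "map f ps" and ?N = "card (monomials m (Suc e))"
  let ?A = "matrix_at (interpolation_matrix m (Suc e) (map f ps)) q"
  have A: "interpolation_matrix m (Suc e) ?vs \<in> carrier_mat ?N ?N"
    using interpolation_matrix_carrier[of m "Suc e" ?vs] square by simp
  have "row ?A i = row ?A j"
    using A ij square by (intro eq_vecI) (auto simp: matrix_at_def interpolation_matrix_index)
  then have "det ?A = 0"
    using ij square A by (intro det_identical_rows[of _ ?N i j]) (auto simp: matrix_at_def)
  then have "has_cone m (Suc e) q (set ?vs)"
    using det_interpolation_matrix_eq_0_iff[of ?vs] square by simp
  moreover have "list_all2 (\<in>) ?vs ps" using f by (simp add: list_all2_conv_all_nth)
  ultimately show False using no_cone by blast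
qed

text \<open>The determinant of the Weddle matrix has to be nonzero as a form in the vertex, and for this one
  vertex with nonzero value suffices. Fixing the first coordinate point as this vertex turns the
  requirement into the nonvanishing of one multihomogeneous polynomial in the points, and the prime
  points show that it can be satisfied.\<close>

lemma general_tuple_no_cone:
  "general_tuple m (card (monoms {1..m} (Suc e))) (\<lambda>ps. set ps \<subseteq> proj_space m \<and>
     length ps = card (monoms {1..m} (Suc e)) \<and>
     (\<forall>vs. list_all2 (\<in>) vs ps \<longrightarrow> \<not> has_cone m (Suc e) (unit_vec (m + 1) 0) (set vs)))"
proof -
  let ?d = "Suc e" and ?r = "card (monoms {1..m} (Suc e))" and ?q = "unit_vec (m + 1) 0 :: complex vec"
  have square: "?r + card (monomials m e) = card (monomials m ?d)"
    using card_monomials_square(3) by simp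
  let ?D = "det (points_matrix m ?d ?r ?q)"
  define U where "U = {ps \<in> point_tuples m ?r. \<exists>f\<in>{?D}. \<forall>vs. list_all2 (\<in>) vs ps \<longrightarrow>
            poly_eval (\<lambda>(i, j). (vs ! i) $ j) f \<noteq> 0}"
  have "multihomogeneous m ?r ?D"
    using square by (intro multihomogeneous_det_points_matrix) simp
  then have "zariski_open m ?r U"
    unfolding zariski_open_def by (intro exI[of _ "{?D}"]) (simp add: U_def)
  moreover have ev: "poly_eval (\<lambda>(i, j). (vs ! i) $ j) ?D = 0 \<longleftrightarrow> has_cone m ?d ?q (set vs)"
    if "length vs = ?r" for vs
    using that square by (simp only: poly_eval_det_points_matrix det_interpolation_matrix_eq_0_iff)
  have len: "length vs = ?r" if "list_all2 (\<in>) vs ps" "ps \<in> point_tuples m ?r"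
    for vs :: "complex vec list" and ps
    using list_all2_lengthD[OF that(1)] that(2) by (simp add: point_tuples_def)
  have U_eq: "ps \<in> U \<longleftrightarrow> set ps \<subseteq> proj_space m \<and> length ps = ?r \<and>
     (\<forall>vs. list_all2 (\<in>) vs ps \<longrightarrow> \<not> has_cone m ?d ?q (set vs))" for ps
    using ev len unfolding U_def point_tuples_def by blast
  moreover have "map (\<lambda>i. proj_point (prime_point m i)) [0..<?r] \<in> U"
  proof -
    let ?us = "map (prime_point m) [0..<?r]"
    let ?ps = "map (\<lambda>i. proj_point (prime_point m i)) [0..<?r]"
    have nz: "prime_point m i \<in> carrier_vec (m + 1)" "prime_point m i \<noteq> 0\<^sub>v (m + 1)" for i
    proof -
      have "prime_point m i $ 0 \<noteq> 0" using prime_nth_prime[of 0] by (auto simp: prime_point_def)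
      then show "prime_point m i \<noteq> 0\<^sub>v (m + 1)" by auto
    qed (simp add: prime_point_def)
    have us: "list_all2 (\<in>) ?us ?ps" by (simp add: list_all2_conv_all_nth)
    have "set ?us = prime_point m ` {..<?r}" by (auto simp: atLeast0LessThan)
    then have no: "\<not> has_cone m ?d ?q (set ?us)" using no_cone_prime_points[of m e] by simp
    have ps: "set ?ps \<subseteq> proj_space m" using nz proj_point_in_proj_space by auto
    have "\<not> has_cone m ?d ?q (set vs)" if "list_all2 (\<in>) vs ?ps" for vs
      using has_cone_same_points[OF us that refl ps] no by blast
    then show ?thesis using ps unfolding U_eq by simp
  qed
  ultimately show ?thesis unfolding general_tuple_def by blast
qed

section \<open>The Weddle scheme as a hypersurface\<close>

text \<open>One vertex without a cone makes the determinant nonzero. The generic rank is then the full size of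
  the matrix, whose only minor of this size is the determinant itself.\<close>

lemma weddle_scheme_principal:
  assumes m: "m \<ge> 1" and square: "length vs + card (monomials m e) = card (monomials m (Suc e))"
    and no_cone: "\<not> has_cone m (Suc e) q (set vs)"
    and q: "q \<in> carrier_vec (m + 1)" "q \<noteq> 0\<^sub>v (m + 1)"
  defines "F \<equiv> det (interpolation_matrix m (Suc e) vs)"
  shows "is_form m (card (monomials m e)) F"
    and "weddle_scheme m (Suc e) vs = genideal (poly_ring m) {F}"
proof -
  let ?A = "interpolation_matrix m (Suc e) vs" and ?N = "card (monomials m (Suc e))"
  have A: "?A \<in> carrier_mat ?N ?N"
    using interpolation_matrix_carrier[of m "Suc e" vs] square by simp
  have keys: "keys F \<subseteq> monomials m (card (monomials m e))"
    unfolding F_def by (rule keys_det_interpolation_matrix[OF square])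
  have det: "det (matrix_at ?A q) \<noteq> 0"
    using det_interpolation_matrix_eq_0_iff[OF square] no_cone by simp
  then have F0: "F \<noteq> 0" by (auto simp: F_def simp flip: poly_eval_det)
  show "is_form m (card (monomials m e)) F" using keys F0 by (simp add: is_form_def)
  have "general_rank m ?A = ?N"
    using general_rank_square[OF A keys[unfolded F_def] q det] .
  then have "weddle_ideal m (Suc e) vs = genideal (poly_ring m) {F}"
    by (simp add: weddle_ideal_def Let_def minors_square[OF A] F_def)
  moreover have "F \<in> carrier (poly_ring m)"
    using keys by (auto simp: carrier_poly_ring monomials_def)
  ultimately show "weddle_scheme m (Suc e) vs = genideal (poly_ring m) {F}"
    using saturation_principal[OF m _ F0] by (simp add: weddle_scheme_def)
qed

lemma scheme_points_principal:
  assumes "F \<in> carrier (poly_ring m)"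
  shows "scheme_points m (genideal (poly_ring m) {F}) = {P \<in> proj_space m. vanishes_at F P}"
proof -
  have "F \<in> genideal (poly_ring m) {F}"
    unfolding genideal_poly_ring[OF assms]
    by (auto intro!: exI[of _ 1] simp: carrier_poly_ring)
  moreover have "vanishes_at f P" if "vanishes_at F P" "f \<in> genideal (poly_ring m) {F}" for f P
    using that by (auto simp: genideal_poly_ring[OF assms] vanishes_at_def poly_eval_mult)
  ultimately show ?thesis by (auto simp: scheme_points_def)
qed

theorem theorem3p2:
  fixes n d :: nat and H :: "complex vec set set"
  assumes "d \<ge> 1"
    and "is_hyperplane (n + 1) H"
  shows "general_set (n + 1) ((d + n) choose n) (\<lambda>Z.
    \<forall>vs. coordinate_reps Z vs \<longrightarrow>
      (\<forall>P \<in> proj_space (n + 1). P \<notin> H \<longrightarrow> P \<notin> Z \<longrightarrow>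
         (P \<in> scheme_points (n + 1) (weddle_scheme (n + 1) d vs) \<longleftrightarrow>
          on_hypersurface (n + 1) H d (projection (n + 1) H P ` Z))) \<and>
      (\<exists>F. is_form (n + 1) ((d + n) choose (n + 1)) F \<and>
         weddle_scheme (n + 1) d vs = genideal (poly_ring (n + 1)) {F}))"
proof -
  define m where "m = n + 1"
  obtain e where d: "d = Suc e" using assms(1) by (cases d) auto
  obtain h where h: "h \<in> carrier_vec (m + 1)"
      and H: "H = {P \<in> proj_space m. \<forall>v\<in>P. scalar_prod h v = 0}"
    using assms(2) by (auto simp: is_hyperplane_def m_def)
  let ?q = "unit_vec (m + 1) 0 :: complex vec"
  have q: "?q \<in> carrier_vec (m + 1)" "?q \<noteq> 0\<^sub>v (m + 1)"
    by (auto simp: vec_eq_iff)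
  have r: "(d + n) choose n = card (monoms {1..m} (Suc e))"
    using binomial_symmetric[of n "d + n"] unfolding card_monomials_square(2) m_def d
    by (simp add: add.commute del: binomial_Suc_Suc)
  have deg: "(d + n) choose (n + 1) = card (monomials m e)"
    using binomial_symmetric[of "n + 1" "d + n"] by (simp add: card_monomials_square(1) m_def d add.commute)
  show ?thesis
    unfolding general_set_def r deg unfolding m_def[symmetric]
  proof -
    have goal: "distinct ps \<and> (\<forall>vs. coordinate_reps (set ps) vs \<longrightarrow>
        (\<forall>P \<in> proj_space m. P \<notin> H \<longrightarrow> P \<notin> set ps \<longrightarrow>
         (P \<in> scheme_points m (weddle_scheme m d vs) \<longleftrightarrow>
          on_hypersurface m H d (projection m H P ` set ps))) \<and>
        (\<exists>F. is_form m (card (monomials m e)) F \<and>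
         weddle_scheme m d vs = genideal (poly_ring m) {F}))"
      if ps: "set ps \<subseteq> proj_space m" "length ps = card (monoms {1..m} (Suc e))"
        and no_cone: "\<And>us. list_all2 (\<in>) us ps \<Longrightarrow> \<not> has_cone m (Suc e) ?q (set us)" for ps
    proof -
      have square: "length ps + card (monomials m e) = card (monomials m (Suc e))"
        using card_monomials_square(3)[of m e] ps(2) by simp
      have dist: "distinct ps" by (rule distinct_if_no_cone[OF square ps(1) no_cone])
      have "(\<forall>P \<in> proj_space m. P \<notin> H \<longrightarrow> P \<notin> set ps \<longrightarrow>
         (P \<in> scheme_points m (weddle_scheme m d vs) \<longleftrightarrow>
          on_hypersurface m H d (projection m H P ` set ps))) \<and>
        (\<exists>F. is_form m (card (monomials m e)) F \<and>
         weddle_scheme m d vs = genideal (poly_ring m) {F})"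
        if vs: "coordinate_reps (set ps) vs" for vs
      proof -
        obtain qs where qs: "distinct qs" "set qs = set ps" "list_all2 (\<in>) vs qs"
          using vs by (auto simp: coordinate_reps_def)
        \<comment> \<open>The coordinate vectors \<open>vs\<close> may list the points in another order, for which nothing is known directly.\<close>
        obtain us where us: "list_all2 (\<in>) us ps" using coordinate_list_exists[OF ps(1)] .
        have "\<not> has_cone m (Suc e) ?q (set vs)"
          using has_cone_same_points[OF us qs(3)] qs(2) ps(1) no_cone[OF us] by auto
        moreover have "length vs = length ps"
          using list_all2_lengthD[OF qs(3)] distinct_card[OF qs(1)] distinct_card[OF dist] qs(2) by simp
        then have sq: "length vs + card (monomials m e) = card (monomials m (Suc e))"
          using square by simp
        moreover have m1: "m \<ge> 1" by (simp add: m_def)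
        ultimately have F: "is_form m (card (monomials m e)) (det (interpolation_matrix m (Suc e) vs))"
            "weddle_scheme m (Suc e) vs = genideal (poly_ring m) {det (interpolation_matrix m (Suc e) vs)}"
          using weddle_scheme_principal[OF m1 sq _ q] by auto
        let ?F = "det (interpolation_matrix m (Suc e) vs)"
        have kF: "keys ?F \<subseteq> monomials m (card (monomials m e))" using F(1) by (simp add: is_form_def)
        then have cF: "?F \<in> carrier (poly_ring m)" by (auto simp: carrier_poly_ring monomials_def)
        have "P \<in> scheme_points m (weddle_scheme m d vs) \<longleftrightarrow>
            on_hypersurface m H d (projection m H P ` set ps)"
          if P: "P \<in> proj_space m" "P \<notin> H" "P \<notin> set ps" for P
        proof -
          obtain p where p: "p \<in> P" using obtain_coordinates[OF P(1)] .
          note pP = proj_spaceD[OF P(1) p]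
          have "P \<in> scheme_points m (weddle_scheme m d vs) \<longleftrightarrow> vanishes_at ?F P"
            using P(1) by (simp add: d F(2) scheme_points_principal[OF cF])
          also have "\<dots> \<longleftrightarrow> poly_eval (\<lambda>j. p $ j) ?F = 0"
            unfolding pP(3) by (rule vanishes_at_proj_point[OF kF pP(1)])
          also have "\<dots> \<longleftrightarrow> has_cone m d p (set vs)"
            by (simp add: poly_eval_det det_interpolation_matrix_eq_0_iff[OF sq] d)
          also have "\<dots> \<longleftrightarrow> on_hypersurface m H d (projection m H P ` set ps)"
          proof (rule on_hypersurface_iff_has_cone[OF h H assms(1) P(1) p P(2) ps(1) P(3), symmetric])
            show "\<exists>x\<in>set vs. x \<in> X" if "X \<in> set ps" for X
              using that qs(2,3) by (metis in_set_conv_nth list_all2_conv_all_nth)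
            show "\<exists>X\<in>set ps. x \<in> X" if "x \<in> set vs" for x
              using that qs(2,3) by (metis in_set_conv_nth list_all2_conv_all_nth)
          qed
          finally show ?thesis .
        qed
        then show ?thesis using F by (auto simp: d)
      qed
      then show ?thesis using dist by blast
    qed
    obtain U where U: "zariski_open m (card (monoms {1..m} (Suc e))) U" "U \<noteq> {}"
        "\<forall>ps\<in>U. set ps \<subseteq> proj_space m \<and> length ps = card (monoms {1..m} (Suc e)) \<and>
          (\<forall>us. list_all2 (\<in>) us ps \<longrightarrow> \<not> has_cone m (Suc e) ?q (set us))"
      using general_tuple_no_cone[of m e] unfolding general_tuple_def by blast
    show "general_tuple m (card (monoms {1..m} (Suc e))) (\<lambda>ps. distinct ps \<and>
        (\<forall>vs. coordinate_reps (set ps) vs \<longrightarrow>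
        (\<forall>P \<in> proj_space m. P \<notin> H \<longrightarrow> P \<notin> set ps \<longrightarrow>
         (P \<in> scheme_points m (weddle_scheme m d vs) \<longleftrightarrow>
          on_hypersurface m H d (projection m H P ` set ps))) \<and>
        (\<exists>F. is_form m (card (monomials m e)) F \<and>
         weddle_scheme m d vs = genideal (poly_ring m) {F})))"
      unfolding general_tuple_def using U goal by (intro exI[of _ U]) blast
  qed
qed

end
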